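(* Let $(E,\mathcal{P})$ be a random locally convex module over $K$ with base $(\Omega,\mathcal{F},P)$. Then $E$ is $\mathcal{T}_{c}$-complete if $E$ is $\mathcal{T}_{\varepsilon,\lambda}$-complete. Furthermore, if $E$ is $\mathcal{T}_{c}$-complete and has the countable concatenation property, then $E$ is also $\mathcal{T}_{\varepsilon,\lambda}$-complete.
   Context: $(\Omega,\mathcal{F},P)$ is a probability space, $K=\mathbb{R}$ or $\mathbb{C}$, and $L^{0}(\mathcal{F},K)$ is the algebra of equivalence classes (under a.s. equality) of $K$-valued $\mathcal{F}$-measurable functions; $L^0(\mathcal F,\mathbb R)$ has a.s. pointwise order and $\vee$ denotes lattice supremum. $L^0_+=\{\xi\in L^0(\mathcal F,\mathbb R):\xi\ge 0\}$; $L^0_{++}$ is the set of $\xi\in L^0_+$ with $\xi>0$ a.s. on $\Omega$. $\tilde I_A$ is the class of the indicator of $A\in\mathcal F$. An $L^0$-seminorm on a left $L^{0}(\mathcal{F},K)$-module $E$ is a map $\|\cdot\|:E\to L^0_+$ with $\|\xi x\|=|\xi|\,\|x\|$ and $\|x+y\|\le\|x\|+\|y\|$ for all $\xi\in L^0(\mathcal F,K)$, $x,y\in E$. A random locally convex module over $K$ with base $(\Omega,\mathcal F,P)$ is a pair $(E,\mathcal P)$ of a left $L^0(\mathcal F,K)$-module $E$ and a family $\mathcal P$ of $L^0$-seminorms on $E$ such that $\vee\{\|x\|:\|\cdot\|\in\mathcal P\}=0$ iff $x=\theta$ (null element). For finite $Q\subset\mathcal P$ put $\|x\|_Q=\vee\{\|x\|:\|\cdot\|\in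 Q\}$. $\mathcal T_{\varepsilon,\lambda}$ is the linear topology on $E$ with local base at $\theta$ formed by the sets $\{x: P\{\omega:\|x\|_Q(\omega)<\varepsilon\}>1-\lambda\}$, $Q\subset\mathcal P$ finite, $\varepsilon>0$, $0<\lambda<1$. $\mathcal T_c$ is the topology in which $G\subset E$ is open iff for every $x\in G$ there are a finite $Q\subset\mathcal P$ and $\varepsilon\in L^0_{++}$ with $x+\{y:\|y\|_Q\le\varepsilon\}\subset G$. Both are Hausdorff group topologies on $E$; completeness means that every Cauchy net converges. $E$ has the countable concatenation property if for every sequence $\{x_n\}$ in $E$ and every countable partition $\{A_n\}$ of $\Omega$ into members of $\mathcal F$ there is $x\in E$ with $\tilde I_{A_n}x=\tilde I_{A_n}x_n$ for all $n$. *)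

theory Defs
  imports "HOL-Probability.Probability" "HOL-Algebra.Module" "HOL-Algebra.AbelCoset"
begin

section \<open>The algebra of equivalence classes of measurable functions\<close>

text \<open>
  The scalar field \<open>K\<close> is a type variable of sort \<open>{real_normed_field, euclidean_space}\<close>.
  The types \<open>real\<close> and \<open>complex\<close> are of this sort, and by Frobenius' theorem a
  finite-dimensional commutative real division algebra is isomorphic to one of these two.
  A class is represented by the set of its members; \<open>L0_rep\<close> selects one of them.
\<close>

definition ae_eq :: "'w measure \<Rightarrow> ('w \<Rightarrow> 'k::euclidean_space) rel" where
  "ae_eq M = {(f, g). f \<in> borel_measurable M \<and> g \<in> borel_measurable M \<and> (AE w in M. f w = g w)}"

definition L0 :: "'w measure \<Rightarrow> ('w \<Rightarrow> 'k::euclidean_space) set set" where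
  "L0 M = borel_measurable M // ae_eq M"

definition L0_class :: "'w measure \<Rightarrow> ('w \<Rightarrow> 'k::euclidean_space) \<Rightarrow> ('w \<Rightarrow> 'k) set" where
  "L0_class M f = ae_eq M `` {f}"

definition L0_rep :: "('w \<Rightarrow> 'k::euclidean_space) set \<Rightarrow> 'w \<Rightarrow> 'k" where
  "L0_rep \<xi> = (SOME f. f \<in> \<xi>)"

definition L0_ring ::
  "'w measure \<Rightarrow> ('w \<Rightarrow> 'k::{real_normed_field,euclidean_space}) set ring" where
  "L0_ring M =
     \<lparr>carrier = L0 M,
      mult = (\<lambda>\<xi> \<eta>. L0_class M (\<lambda>w. L0_rep \<xi> w * L0_rep \<eta> w)),
      one = L0_class M (\<lambda>_. 1),
      zero = L0_class M (\<lambda>_. 0),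
      add = (\<lambda>\<xi> \<eta>. L0_class M (\<lambda>w. L0_rep \<xi> w + L0_rep \<eta> w))\<rparr>"

definition L0_abs :: "'w measure \<Rightarrow> ('w \<Rightarrow> 'k::euclidean_space) set \<Rightarrow> ('w \<Rightarrow> real) set" where
  "L0_abs M \<xi> = L0_class M (\<lambda>w. norm (L0_rep \<xi> w))"

definition L0_ind :: "'w measure \<Rightarrow> 'w set \<Rightarrow> ('w \<Rightarrow> 'k::{real_normed_field,euclidean_space}) set" where
  "L0_ind M A = L0_class M (indicator A)"

definition L0_le :: "'w measure \<Rightarrow> ('w \<Rightarrow> real) set \<Rightarrow> ('w \<Rightarrow> real) set \<Rightarrow> bool" where
  "L0_le M \<xi> \<eta> \<longleftrightarrow> (AE w in M. L0_rep \<xi> w \<le> L0_rep \<eta> w)"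

definition L0_plus :: "'w measure \<Rightarrow> ('w \<Rightarrow> real) set set" where
  "L0_plus M = {\<xi> \<in> L0 M. L0_le M \<zero>\<^bsub>L0_ring M\<^esub> \<xi>}"

definition L0_pp :: "'w measure \<Rightarrow> ('w \<Rightarrow> real) set set" where
  "L0_pp M = {\<xi> \<in> L0_plus M. AE w in M. L0_rep \<xi> w > 0}"

text \<open>
  Suprema of values of \<open>L0\<close>-seminorms are taken in the partially ordered set of nonnegative
  classes, so that the supremum of the empty family is \<open>0\<close>.
\<close>

definition L0_order :: "'w measure \<Rightarrow> ('w \<Rightarrow> real) set gorder" where
  "L0_order M = \<lparr>carrier = L0_plus M, eq = (=), le = L0_le M\<rparr>"

section \<open>Random locally convex modules\<close>

definition L0_seminorm ::
  "'w measure \<Rightarrow> (('w \<Rightarrow> 'k::{real_normed_field,euclidean_space}) set, 'e) module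
     \<Rightarrow> ('e \<Rightarrow> ('w \<Rightarrow> real) set) \<Rightarrow> bool" where
  "L0_seminorm M E p \<longleftrightarrow>
     (\<forall>x\<in>carrier E. p x \<in> L0_plus M) \<and>
     (\<forall>\<xi>\<in>L0 M. \<forall>x\<in>carrier E. p (\<xi> \<odot>\<^bsub>E\<^esub> x) = L0_abs M \<xi> \<otimes>\<^bsub>L0_ring M\<^esub> p x) \<and>
     (\<forall>x\<in>carrier E. \<forall>y\<in>carrier E. L0_le M (p (x \<oplus>\<^bsub>E\<^esub> y)) (p x \<oplus>\<^bsub>L0_ring M\<^esub> p y))"

text \<open>
  For infinite \<open>P\<close> the supremum of all \<open>p x\<close> need not be finite, hence the separation axiom says
  that \<open>0\<close> is the least upper bound instead of using the choice-based operator \<open>\<Squnion>\<close>.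
\<close>

definition random_locally_convex_module ::
  "'w measure \<Rightarrow> (('w \<Rightarrow> 'k::{real_normed_field,euclidean_space}) set, 'e) module
     \<Rightarrow> ('e \<Rightarrow> ('w \<Rightarrow> real) set) set \<Rightarrow> bool" where
  "random_locally_convex_module M E P \<longleftrightarrow>
     prob_space M \<and> Module.module (L0_ring M) E \<and>
     (\<forall>p\<in>P. L0_seminorm M E p) \<and>
     (\<forall>x\<in>carrier E.
        least (L0_order M) \<zero>\<^bsub>L0_ring M\<^esub> (Upper (L0_order M) ((\<lambda>p. p x) ` P)) \<longleftrightarrow> x = \<zero>\<^bsub>E\<^esub>)"

definition sup_norm ::
  "'w measure \<Rightarrow> ('e \<Rightarrow> ('w \<Rightarrow> real) set) set \<Rightarrow> 'e \<Rightarrow> ('w \<Rightarrow> real) set" where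
  "sup_norm M Q x = \<Squnion>\<^bsub>L0_order M\<^esub> ((\<lambda>p. p x) ` Q)"

definition nbhd_eps_lambda ::
  "'w measure \<Rightarrow> (('w \<Rightarrow> 'k::{real_normed_field,euclidean_space}) set, 'e) module
     \<Rightarrow> ('e \<Rightarrow> ('w \<Rightarrow> real) set) set \<Rightarrow> real \<Rightarrow> real \<Rightarrow> 'e set" where
  "nbhd_eps_lambda M E Q \<epsilon> \<delta> =
     {y \<in> carrier E. measure M {w \<in> space M. L0_rep (sup_norm M Q y) w < \<epsilon>} > 1 - \<delta>}"

definition nbhd_c ::
  "'w measure \<Rightarrow> (('w \<Rightarrow> 'k::{real_normed_field,euclidean_space}) set, 'e) module
     \<Rightarrow> ('e \<Rightarrow> ('w \<Rightarrow> real) set) set \<Rightarrow> ('w \<Rightarrow> real) set \<Rightarrow> 'e set" where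
  "nbhd_c M E Q \<epsilon> = {y \<in> carrier E. L0_le M (sup_norm M Q y) \<epsilon>}"

text \<open>
  A translation-invariant topology is determined by a local base at \<open>0\<close>: a set is open iff with
  each of its points \<open>x\<close> it contains \<open>x + N\<close> for some member \<open>N\<close> of the local base.
\<close>

definition T_eps_lambda ::
  "'w measure \<Rightarrow> (('w \<Rightarrow> 'k::{real_normed_field,euclidean_space}) set, 'e) module
     \<Rightarrow> ('e \<Rightarrow> ('w \<Rightarrow> real) set) set \<Rightarrow> 'e topology" where
  "T_eps_lambda M E P = topology (\<lambda>G. G \<subseteq> carrier E \<and>
     (\<forall>x\<in>G. \<exists>Q \<epsilon> \<delta>. finite Q \<and> Q \<subseteq> P \<and> 0 < \<epsilon> \<and> 0 < \<delta> \<and> \<delta> < 1 \<and>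
        x <+\<^bsub>E\<^esub> nbhd_eps_lambda M E Q \<epsilon> \<delta> \<subseteq> G))"

definition T_c ::
  "'w measure \<Rightarrow> (('w \<Rightarrow> 'k::{real_normed_field,euclidean_space}) set, 'e) module
     \<Rightarrow> ('e \<Rightarrow> ('w \<Rightarrow> real) set) set \<Rightarrow> 'e topology" where
  "T_c M E P = topology (\<lambda>G. G \<subseteq> carrier E \<and>
     (\<forall>x\<in>G. \<exists>Q \<epsilon>. finite Q \<and> Q \<subseteq> P \<and> \<epsilon> \<in> L0_pp M \<and> x <+\<^bsub>E\<^esub> nbhd_c M E Q \<epsilon> \<subseteq> G))"

definition countable_concatenation_property ::
  "'w measure \<Rightarrow> (('w \<Rightarrow> 'k::{real_normed_field,euclidean_space}) set, 'e) module \<Rightarrow> bool" where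
  "countable_concatenation_property M E \<longleftrightarrow>
     (\<forall>x A. range x \<subseteq> carrier E \<and> range A \<subseteq> sets M \<and> disjoint_family A \<and>
            (\<Union>n::nat. A n) = space M \<longrightarrow>
        (\<exists>y\<in>carrier E. \<forall>n. L0_ind M (A n) \<odot>\<^bsub>E\<^esub> y = L0_ind M (A n) \<odot>\<^bsub>E\<^esub> x n))"

section \<open>Completeness in terms of nets\<close>

definition directed :: "'i set \<Rightarrow> 'i rel \<Rightarrow> bool" where
  "directed I r \<longleftrightarrow> I \<noteq> {} \<and> preorder_on I r \<and> (\<forall>i\<in>I. \<forall>j\<in>I. \<exists>k\<in>I. (i, k) \<in> r \<and> (j, k) \<in> r)"

definition net_converges :: "'e topology \<Rightarrow> 'i set \<Rightarrow> 'i rel \<Rightarrow> ('i \<Rightarrow> 'e) \<Rightarrow> 'e \<Rightarrow> bool" where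
  "net_converges T I r x l \<longleftrightarrow> l \<in> topspace T \<and>
     (\<forall>U. openin T U \<and> l \<in> U \<longrightarrow> (\<exists>i\<in>I. \<forall>j\<in>I. (i, j) \<in> r \<longrightarrow> x j \<in> U))"

definition Cauchy_net ::
  "('e, 'm) ring_scheme \<Rightarrow> 'e topology \<Rightarrow> 'i set \<Rightarrow> 'i rel \<Rightarrow> ('i \<Rightarrow> 'e) \<Rightarrow> bool" where
  "Cauchy_net G T I r x \<longleftrightarrow> x ` I \<subseteq> carrier G \<and>
     (\<forall>U. openin T U \<and> \<zero>\<^bsub>G\<^esub> \<in> U \<longrightarrow>
        (\<exists>i\<in>I. \<forall>j\<in>I. \<forall>k\<in>I. (i, j) \<in> r \<and> (i, k) \<in> r \<longrightarrow> x j \<ominus>\<^bsub>G\<^esub> x k \<in> U))"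

text \<open>
  A formula cannot quantify over all index types. The index type used here is large enough to
  cover nets over every index type, as \<open>net_complete_any_index\<close> shows.
\<close>

definition net_complete :: "('e, 'm) ring_scheme \<Rightarrow> 'e topology \<Rightarrow> bool" where
  "net_complete G T \<longleftrightarrow>
     (\<forall>(I :: ('e set \<times> 'e) set) r x. directed I r \<and> Cauchy_net G T I r x \<longrightarrow>
        (\<exists>l. net_converges T I r x l))"

lemma net_complete_any_index:
  fixes I :: "'i set" and x :: "'i \<Rightarrow> 'e"
  assumes complete: "net_complete G T" and dir: "directed I r" and cauchy: "Cauchy_net G T I r x"
  shows "\<exists>l. net_converges T I r x l"
proof -
  define tail where "tail i = x ` {j \<in> I. (i, j) \<in> r}" for i
  define J where "J = {(tail i, y) | i y. i \<in> I \<and> y \<in> tail i}"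
  define s where "s = {(a, b). a \<in> J \<and> b \<in> J \<and> fst b \<subseteq> fst a}"
  have ne: "I \<noteq> {}" and refl: "(i, i) \<in> r" if "i \<in> I" for i
    using dir that by (auto simp: directed_def preorder_on_def refl_on_def)
  have ne: "I \<noteq> {}" using dir by (auto simp: directed_def)
  have trans: "(i, k) \<in> r" if "(i, j) \<in> r" "(j, k) \<in> r" for i j k
    using dir that unfolding directed_def preorder_on_def by (meson transD)
  have tail_self: "x i \<in> tail i" if "i \<in> I" for i
    using that refl by (auto simp: tail_def)
  have tail_mono: "tail j \<subseteq> tail i" if "(i, j) \<in> r" for i j
    using that trans by (auto simp: tail_def)
  have JI: "(tail i, x i) \<in> J" if "i \<in> I" for i
    using that tail_self by (auto simp: J_def)
  have "directed J s"
    unfolding directed_def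
  proof (intro conjI ballI)
    show "J \<noteq> {}" using JI ne by blast
    show "preorder_on J s"
      by (auto simp: preorder_on_def refl_on_def trans_def s_def)
    fix a b assume ab: "a \<in> J" "b \<in> J"
    then obtain i j where ij: "i \<in> I" "j \<in> I" "fst a = tail i" "fst b = tail j"
      by (auto simp: J_def)
    then obtain k where k: "k \<in> I" "(i, k) \<in> r" "(j, k) \<in> r"
      using dir unfolding directed_def by blast
    show "\<exists>c\<in>J. (a, c) \<in> s \<and> (b, c) \<in> s"
      using ab ij k JI[OF k(1)] tail_mono by (intro bexI[of _ "(tail k, x k)"]) (auto simp: s_def)
  qed
  moreover have "Cauchy_net G T J s snd"
    unfolding Cauchy_net_def
  proof (intro conjI allI impI)
    show "snd ` J \<subseteq> carrier G"
      using cauchy by (auto simp: Cauchy_net_def J_def tail_def)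
    fix U assume "openin T U \<and> \<zero>\<^bsub>G\<^esub> \<in> U"
    then obtain i where i: "i \<in> I"
        "\<And>j k. j \<in> I \<Longrightarrow> k \<in> I \<Longrightarrow> (i, j) \<in> r \<Longrightarrow> (i, k) \<in> r \<Longrightarrow> x j \<ominus>\<^bsub>G\<^esub> x k \<in> U"
      using cauchy unfolding Cauchy_net_def by meson
    have in_tail: "snd a \<in> tail i" if "((tail i, x i), a) \<in> s" for a
      using that by (auto simp: s_def J_def)
    show "\<exists>c\<in>J. \<forall>a\<in>J. \<forall>b\<in>J. (c, a) \<in> s \<and> (c, b) \<in> s \<longrightarrow> snd a \<ominus>\<^bsub>G\<^esub> snd b \<in> U"
    proof (intro bexI[OF _ JI[OF i(1)]] ballI impI)
      fix a b assume "((tail i, x i), a) \<in> s \<and> ((tail i, x i), b) \<in> s"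
      then have "snd a \<in> tail i" "snd b \<in> tail i" using in_tail by blast+
      then show "snd a \<ominus>\<^bsub>G\<^esub> snd b \<in> U" using i(2) by (auto simp: tail_def)
    qed
  qed
  ultimately obtain l where l: "net_converges T J s snd l"
    using complete unfolding net_complete_def by meson
  have "net_converges T I r x l"
    unfolding net_converges_def
  proof (intro conjI allI impI)
    show "l \<in> topspace T" using l by (simp add: net_converges_def)
    fix U assume "openin T U \<and> l \<in> U"
    then obtain a where a: "a \<in> J" "\<And>b. b \<in> J \<Longrightarrow> (a, b) \<in> s \<Longrightarrow> snd b \<in> U"
      using l unfolding net_converges_def by meson
    then obtain i where i: "i \<in> I" "fst a = tail i" by (auto simp: J_def)
    have "x j \<in> U" if "j \<in> I" "(i, j) \<in> r" for j
      using a(2)[OF JI[OF that(1)]] a(1) JI[OF that(1)] i tail_mono[OF that(2)]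
      by (auto simp: s_def)
    with i(1) show "\<exists>i\<in>I. \<forall>j\<in>I. (i, j) \<in> r \<longrightarrow> x j \<in> U" by blast
  qed
  then show ?thesis ..
qed

section \<open>Well-definedness\<close>

lemma equiv_ae_eq:
  fixes M :: "'w measure"
  shows "equiv (borel_measurable M) (ae_eq M :: ('w \<Rightarrow> 'k::euclidean_space) rel)"
proof (rule equivI)
  show "trans (ae_eq M :: ('w \<Rightarrow> 'k) rel)"
  proof (rule transI)
    fix f g h :: "'w \<Rightarrow> 'k" assume *: "(f, g) \<in> ae_eq M" "(g, h) \<in> ae_eq M"
    then have "AE w in M. f w = g w" "AE w in M. g w = h w" by (auto simp: ae_eq_def)
    then have "AE w in M. f w = h w" by eventually_elim simp
    with * show "(f, h) \<in> ae_eq M" by (auto simp: ae_eq_def)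
  qed
qed (auto simp: ae_eq_def refl_on_def sym_def eq_commute)

lemma L0_class_in: "f \<in> borel_measurable M \<Longrightarrow> L0_class M f \<in> L0 M"
  by (simp add: L0_class_def L0_def quotientI)

lemma L0_rep_in: assumes "\<xi> \<in> L0 M" shows "L0_rep \<xi> \<in> \<xi>"
proof -
  have "\<xi> \<noteq> {}" using assms in_quotient_imp_non_empty[OF equiv_ae_eq] by (auto simp: L0_def)
  then show ?thesis by (simp add: L0_rep_def some_in_eq)
qed

lemma L0_rep_measurable: assumes "\<xi> \<in> L0 M" shows "L0_rep \<xi> \<in> borel_measurable M"
  using L0_rep_in[OF assms] in_quotient_imp_subset[OF equiv_ae_eq] assms by (auto simp: L0_def)

lemma L0_class_rep: assumes "\<xi> \<in> L0 M" shows "L0_class M (L0_rep \<xi>) = \<xi>"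
proof -
  obtain f where f: "\<xi> = ae_eq M `` {f}" using assms by (auto simp: L0_def elim: quotientE)
  then have "(f, L0_rep \<xi>) \<in> ae_eq M" using L0_rep_in[OF assms] by simp
  from equiv_class_eq[OF equiv_ae_eq this] show ?thesis by (simp add: L0_class_def f)
qed

lemma L0_rep_class:
  assumes "f \<in> borel_measurable M" shows "AE w in M. L0_rep (L0_class M f) w = f w"
proof -
  have "L0_rep (L0_class M f) \<in> L0_class M f" using L0_rep_in[OF L0_class_in[OF assms]] .
  then show ?thesis by (auto simp: L0_class_def ae_eq_def eq_commute)
qed

lemma L0_class_eqI:
  assumes "f \<in> borel_measurable M" "g \<in> borel_measurable M" "AE w in M. f w = g w"
  shows "L0_class M f = L0_class M g"
  using assms equiv_class_eq[OF equiv_ae_eq] by (auto simp: L0_class_def ae_eq_def)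

lemma L0_eqI:
  assumes "\<xi> \<in> L0 M" "\<eta> \<in> L0 M" "AE w in M. L0_rep \<xi> w = L0_rep \<eta> w"
  shows "\<xi> = \<eta>"
  using L0_class_eqI[OF L0_rep_measurable[OF assms(1)] L0_rep_measurable[OF assms(2)] assms(3)]
  by (simp add: L0_class_rep[OF assms(1)] L0_class_rep[OF assms(2)])

lemma cring_L0_ring:
  fixes M :: "'w measure"
  shows "cring (L0_ring M :: ('w \<Rightarrow> 'k::{real_normed_field,euclidean_space}) set ring)"
proof -
  let ?R = "L0_ring M :: ('w \<Rightarrow> 'k) set ring"
  have add_in: "x \<oplus>\<^bsub>?R\<^esub> y \<in> L0 M" and mult_in: "x \<otimes>\<^bsub>?R\<^esub> y \<in> L0 M"
    and rep_add: "AE w in M. L0_rep (x \<oplus>\<^bsub>?R\<^esub> y) w = L0_rep x w + L0_rep y w"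
    and rep_mult: "AE w in M. L0_rep (x \<otimes>\<^bsub>?R\<^esub> y) w = L0_rep x w * L0_rep y w"
    if "x \<in> L0 M" "y \<in> L0 M" for x y :: "('w \<Rightarrow> 'k) set"
    using that[THEN L0_rep_measurable] unfolding L0_ring_def
    by (auto intro!: L0_class_in L0_rep_class)
  have const_in: "\<one>\<^bsub>?R\<^esub> \<in> L0 M" "\<zero>\<^bsub>?R\<^esub> \<in> L0 M"
    and rep_one: "AE w in M. L0_rep \<one>\<^bsub>?R\<^esub> w = 1"
    and rep_zero: "AE w in M. L0_rep \<zero>\<^bsub>?R\<^esub> w = 0"
    unfolding L0_ring_def by (auto intro!: L0_class_in L0_rep_class)
  have carr: "carrier ?R = L0 M" by (simp add: L0_ring_def)
  show ?thesis
  proof (intro cringI abelian_groupI comm_monoidI, unfold carr)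
    fix x y z :: "('w \<Rightarrow> 'k) set"
    assume x: "x \<in> L0 M" and y: "y \<in> L0 M"
    show "x \<oplus>\<^bsub>?R\<^esub> y \<in> L0 M" "x \<otimes>\<^bsub>?R\<^esub> y \<in> L0 M" by (rule add_in mult_in; fact x y)+
    have "AE w in M. L0_rep (x \<oplus>\<^bsub>?R\<^esub> y) w = L0_rep (y \<oplus>\<^bsub>?R\<^esub> x) w"
      using rep_add[OF x y] rep_add[OF y x]
      by eventually_elim (simp add: algebra_simps)
    from L0_eqI[OF _ _ this] show "x \<oplus>\<^bsub>?R\<^esub> y = y \<oplus>\<^bsub>?R\<^esub> x"
      by (simp add: add_in mult_in const_in x y)
    have "AE w in M. L0_rep (x \<otimes>\<^bsub>?R\<^esub> y) w = L0_rep (y \<otimes>\<^bsub>?R\<^esub> x) w"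
      using rep_mult[OF x y] rep_mult[OF y x]
      by eventually_elim (simp add: algebra_simps)
    from L0_eqI[OF _ _ this] show "x \<otimes>\<^bsub>?R\<^esub> y = y \<otimes>\<^bsub>?R\<^esub> x"
      by (simp add: add_in mult_in const_in x y)
    assume z: "z \<in> L0 M"
    have "AE w in M. L0_rep ((x \<oplus>\<^bsub>?R\<^esub> y) \<oplus>\<^bsub>?R\<^esub> z) w = L0_rep (x \<oplus>\<^bsub>?R\<^esub> (y \<oplus>\<^bsub>?R\<^esub> z)) w"
      using rep_add[OF x y] rep_add[OF y z] rep_add[OF add_in[OF x y] z] rep_add[OF x add_in[OF y z]]
      by eventually_elim (simp add: algebra_simps)
    from L0_eqI[OF _ _ this] show "(x \<oplus>\<^bsub>?R\<^esub> y) \<oplus>\<^bsub>?R\<^esub> z = x \<oplus>\<^bsub>?R\<^esub> (y \<oplus>\<^bsub>?R\<^esub> z)"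
      by (simp add: add_in mult_in const_in x y z)
    have "AE w in M. L0_rep ((x \<otimes>\<^bsub>?R\<^esub> y) \<otimes>\<^bsub>?R\<^esub> z) w = L0_rep (x \<otimes>\<^bsub>?R\<^esub> (y \<otimes>\<^bsub>?R\<^esub> z)) w"
      using rep_mult[OF x y] rep_mult[OF y z] rep_mult[OF mult_in[OF x y] z] rep_mult[OF x mult_in[OF y z]]
      by eventually_elim (simp add: algebra_simps)
    from L0_eqI[OF _ _ this] show "(x \<otimes>\<^bsub>?R\<^esub> y) \<otimes>\<^bsub>?R\<^esub> z = x \<otimes>\<^bsub>?R\<^esub> (y \<otimes>\<^bsub>?R\<^esub> z)"
      by (simp add: add_in mult_in const_in x y z)
    have "AE w in M. L0_rep ((x \<oplus>\<^bsub>?R\<^esub> y) \<otimes>\<^bsub>?R\<^esub> z) w = L0_rep (x \<otimes>\<^bsub>?R\<^esub> z \<oplus>\<^bsub>?R\<^esub> y \<otimes>\<^bsub>?R\<^esub> z) w"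
      using rep_add[OF x y] rep_mult[OF x z] rep_mult[OF y z] rep_mult[OF add_in[OF x y] z] rep_add[OF mult_in[OF x z] mult_in[OF y z]]
      by eventually_elim (simp add: algebra_simps)
    from L0_eqI[OF _ _ this] show "(x \<oplus>\<^bsub>?R\<^esub> y) \<otimes>\<^bsub>?R\<^esub> z = x \<otimes>\<^bsub>?R\<^esub> z \<oplus>\<^bsub>?R\<^esub> y \<otimes>\<^bsub>?R\<^esub> z"
      by (simp add: add_in mult_in const_in x y z)
  next
    fix x :: "('w \<Rightarrow> 'k) set"
    assume x: "x \<in> L0 M"
    have "AE w in M. L0_rep (\<zero>\<^bsub>?R\<^esub> \<oplus>\<^bsub>?R\<^esub> x) w = L0_rep (x) w"
      using rep_add[OF const_in(2) x] rep_zero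
      by eventually_elim (simp add: algebra_simps)
    from L0_eqI[OF _ _ this] show "\<zero>\<^bsub>?R\<^esub> \<oplus>\<^bsub>?R\<^esub> x = x"
      by (simp add: add_in mult_in const_in x)
    have "AE w in M. L0_rep (\<one>\<^bsub>?R\<^esub> \<otimes>\<^bsub>?R\<^esub> x) w = L0_rep (x) w"
      using rep_mult[OF const_in(1) x] rep_one
      by eventually_elim (simp add: algebra_simps)
    from L0_eqI[OF _ _ this] show "\<one>\<^bsub>?R\<^esub> \<otimes>\<^bsub>?R\<^esub> x = x"
      by (simp add: add_in mult_in const_in x)
    have m: "(\<lambda>w. - L0_rep x w) \<in> borel_measurable M" using L0_rep_measurable[OF x] by simp
    let ?y = "L0_class M (\<lambda>w. - L0_rep x w)"
    have y: "?y \<in> L0 M" by (rule L0_class_in[OF m])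
    have "AE w in M. L0_rep (?y \<oplus>\<^bsub>?R\<^esub> x) w = L0_rep (\<zero>\<^bsub>?R\<^esub>) w"
      using rep_add[OF y x] rep_zero L0_rep_class[OF m]
      by eventually_elim (simp add: algebra_simps)
    from L0_eqI[OF _ _ this] have "?y \<oplus>\<^bsub>?R\<^esub> x = \<zero>\<^bsub>?R\<^esub>"
      by (simp add: add_in mult_in const_in x y)
    with y show "\<exists>y\<in>L0 M. y \<oplus>\<^bsub>?R\<^esub> x = \<zero>\<^bsub>?R\<^esub>" by blast
  qed (fact const_in)+
qed

lemma L0_plus_iff: "\<xi> \<in> L0_plus M \<longleftrightarrow> \<xi> \<in> L0 M \<and> (AE w in M. 0 \<le> L0_rep \<xi> w)"
proof -
  have z: "AE w in M. L0_rep \<zero>\<^bsub>L0_ring M\<^esub> w = (0::real)"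
    by (auto simp: L0_ring_def intro!: L0_rep_class)
  have "(AE w in M. L0_rep \<zero>\<^bsub>L0_ring M\<^esub> w \<le> L0_rep \<xi> w) \<longleftrightarrow> (AE w in M. 0 \<le> L0_rep \<xi> w)"
    by (rule eventually_subst) (use z in \<open>eventually_elim; simp\<close>)
  then show ?thesis by (simp add: L0_plus_def L0_le_def)
qed

lemma least_UpperI_L0:
  assumes "s \<in> L0_plus M" "\<And>a. a \<in> A \<Longrightarrow> L0_le M a s" "A \<subseteq> L0_plus M"
    and "\<And>u. u \<in> L0_plus M \<Longrightarrow> (\<And>a. a \<in> A \<Longrightarrow> L0_le M a u) \<Longrightarrow> L0_le M s u"
  shows "least (L0_order M) s (Upper (L0_order M) A)"
proof -
  have A: "A \<inter> L0_plus M = A" using assms(3) by blast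
  show ?thesis unfolding least_def Upper_def using assms A by (simp add: L0_order_def subset_eq)
qed

lemma L0_order_finite_sup:
  assumes "finite A" "A \<subseteq> L0_plus M"
  shows "least (L0_order M) (\<Squnion>\<^bsub>L0_order M\<^esub> A) (Upper (L0_order M) A)"
proof -
  have "\<exists>s. least (L0_order M) s (Upper (L0_order M) A)"
    using assms
  proof (induction A)
    case empty
    have "L0_class M (\<lambda>_. 0) \<in> L0_plus M"
      using L0_rep_class[of "\<lambda>_. 0::real" M] by (auto simp: L0_plus_iff L0_class_in)
    then show ?case
      by (intro exI[of _ "L0_class M (\<lambda>_. 0)"])
        (auto simp: least_def Upper_def L0_order_def L0_plus_def L0_ring_def)
  next
    case (insert a A)
    then obtain s where s: "least (L0_order M) s (Upper (L0_order M) A)" by auto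
    have a: "a \<in> L0_plus M" and A: "A \<subseteq> L0_plus M" using insert by auto
    have sp: "s \<in> L0_plus M" using s by (auto simp: least_def Upper_def L0_order_def)
    have sA: "L0_le M b s" if "b \<in> A" for b
      using s A that by (auto simp: least_def Upper_def L0_order_def)
    have sl: "L0_le M s u" if "u \<in> L0_plus M" "\<And>b. b \<in> A \<Longrightarrow> L0_le M b u" for u
      using s that by (auto simp: least_def Upper_def L0_order_def)
    have [measurable]: "L0_rep a \<in> borel_measurable M" "L0_rep s \<in> borel_measurable M"
      using a sp by (auto simp: L0_plus_iff L0_rep_measurable)
    let ?t = "L0_class M (\<lambda>w. max (L0_rep a w) (L0_rep s w))"
    have t: "AE w in M. L0_rep ?t w = max (L0_rep a w) (L0_rep s w)"
      by (rule L0_rep_class) measurable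
    have tin: "?t \<in> L0 M" by (rule L0_class_in) measurable
    have a0: "AE w in M. 0 \<le> L0_rep a w" using a by (simp add: L0_plus_iff)
    have "AE w in M. 0 \<le> L0_rep ?t w" using t a0 by eventually_elim simp
    with tin have tp: "?t \<in> L0_plus M" by (simp add: L0_plus_iff)
    have ta: "L0_le M a ?t" using t unfolding L0_le_def by eventually_elim simp
    have ts: "L0_le M s ?t" using t unfolding L0_le_def by eventually_elim simp
    have le_trans: "L0_le M b d" if "L0_le M b c" "L0_le M c d" for b c d
      using that unfolding L0_le_def by eventually_elim simp
    have tl: "L0_le M ?t u" if "L0_le M a u" "L0_le M s u" for u
      using t that unfolding L0_le_def by eventually_elim simp
    have "least (L0_order M) ?t (Upper (L0_order M) (insert a A))"
    proof (rule least_UpperI_L0[OF tp])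
      show "L0_le M b ?t" if "b \<in> insert a A" for b
        using that ta le_trans[OF sA ts] by blast
      show "L0_le M ?t u" if "u \<in> L0_plus M" "\<And>b. b \<in> insert a A \<Longrightarrow> L0_le M b u" for u
        using that by (intro tl sl) auto
    qed (use a A in simp)
    then show ?case by blast
  qed
  then show ?thesis unfolding Lattice.sup_def by (rule someI_ex)
qed

context
  fixes M :: "'w measure"
    and E :: "(('w \<Rightarrow> 'k::{real_normed_field,euclidean_space}) set, 'e) module"
    and P :: "('e \<Rightarrow> ('w \<Rightarrow> real) set) set"
  assumes rlcm: "random_locally_convex_module M E P"
begin

lemma sup_norm_mono:
  assumes "finite Q" "Q \<subseteq> P" "R \<subseteq> Q" "y \<in> carrier E"
  shows "sup_norm M Q y \<in> L0_plus M" "L0_le M (sup_norm M R y) (sup_norm M Q y)"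
proof -
  have *: "(\<lambda>p. p y) ` Q \<subseteq> L0_plus M" "(\<lambda>p. p y) ` R \<subseteq> L0_plus M"
    using rlcm assms by (auto simp: random_locally_convex_module_def L0_seminorm_def)
  have l: "least (L0_order M) (sup_norm M Q y) (Upper (L0_order M) ((\<lambda>p. p y) ` Q))"
      "least (L0_order M) (sup_norm M R y) (Upper (L0_order M) ((\<lambda>p. p y) ` R))"
    unfolding sup_norm_def using assms * by (auto intro!: L0_order_finite_sup intro: finite_subset)
  show "sup_norm M Q y \<in> L0_plus M"
    using l(1) by (auto simp: least_def Upper_def L0_order_def)
  have "sup_norm M Q y \<in> Upper (L0_order M) ((\<lambda>p. p y) ` R)"
    using l(1) assms(3) by (auto simp: least_def Upper_def L0_order_def)
  with l(2) show "L0_le M (sup_norm M R y) (sup_norm M Q y)"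
    by (auto simp: least_def L0_order_def)
qed

lemma openin_T_eps_lambda:
  "openin (T_eps_lambda M E P) G \<longleftrightarrow> G \<subseteq> carrier E \<and>
     (\<forall>x\<in>G. \<exists>Q \<epsilon> \<delta>. finite Q \<and> Q \<subseteq> P \<and> 0 < \<epsilon> \<and> 0 < \<delta> \<and> \<delta> < 1 \<and>
        x <+\<^bsub>E\<^esub> nbhd_eps_lambda M E Q \<epsilon> \<delta> \<subseteq> G)"
proof -
  interpret prob_space M using rlcm by (simp add: random_locally_convex_module_def)
  have mono: "nbhd_eps_lambda M E Q \<epsilon> \<delta> \<subseteq> nbhd_eps_lambda M E R \<epsilon>' \<delta>'"
    if "finite Q" "Q \<subseteq> P" "R \<subseteq> Q" "\<epsilon> \<le> \<epsilon>'" "\<delta> \<le> \<delta>'" for Q R \<epsilon> \<epsilon>' \<delta> \<delta>'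
  proof
    fix y assume "y \<in> nbhd_eps_lambda M E Q \<epsilon> \<delta>"
    then have y: "y \<in> carrier E" "prob {w \<in> space M. L0_rep (sup_norm M Q y) w < \<epsilon>} > 1 - \<delta>"
      by (auto simp: nbhd_eps_lambda_def)
    have [measurable]: "L0_rep (sup_norm M R y) \<in> borel_measurable M"
      using sup_norm_mono(1)[of R R y] y finite_subset[OF that(3,1)] that(2,3)
      by (simp add: L0_plus_iff L0_rep_measurable)
    have [measurable]: "L0_rep (sup_norm M Q y) \<in> borel_measurable M"
      using sup_norm_mono(1)[of Q Q y] y that by (simp add: L0_plus_iff L0_rep_measurable)
    have "AE w in M. L0_rep (sup_norm M R y) w \<le> L0_rep (sup_norm M Q y) w"
      using sup_norm_mono(2)[OF that(1-3) y(1)] by (simp add: L0_le_def)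
    then have "AE w in M. w \<in> {w \<in> space M. L0_rep (sup_norm M Q y) w < \<epsilon>} \<longrightarrow>
        w \<in> {w \<in> space M. L0_rep (sup_norm M R y) w < \<epsilon>'}"
      by eventually_elim (use \<open>\<epsilon> \<le> \<epsilon>'\<close> in simp)
    then have "prob {w \<in> space M. L0_rep (sup_norm M Q y) w < \<epsilon>}
        \<le> prob {w \<in> space M. L0_rep (sup_norm M R y) w < \<epsilon>'}"
      by (rule finite_measure_mono_AE) measurable
    with y that show "y \<in> nbhd_eps_lambda M E R \<epsilon>' \<delta>'" by (auto simp: nbhd_eps_lambda_def)
  qed
  show ?thesis
    unfolding T_eps_lambda_def
  proof (subst topology_inverse', unfold istopology_def, intro conjI allI impI ballI)
    fix G H x
    assume G: "G \<subseteq> carrier E \<and> (\<forall>x\<in>G. \<exists>Q \<epsilon> \<delta>. finite Q \<and> Q \<subseteq> P \<and> 0 < \<epsilon> \<and> 0 < \<delta> \<and> \<delta> < 1 \<and>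
        x <+\<^bsub>E\<^esub> nbhd_eps_lambda M E Q \<epsilon> \<delta> \<subseteq> G)"
      and H: "H \<subseteq> carrier E \<and> (\<forall>x\<in>H. \<exists>Q \<epsilon> \<delta>. finite Q \<and> Q \<subseteq> P \<and> 0 < \<epsilon> \<and> 0 < \<delta> \<and> \<delta> < 1 \<and>
        x <+\<^bsub>E\<^esub> nbhd_eps_lambda M E Q \<epsilon> \<delta> \<subseteq> H)"
    then show "G \<inter> H \<subseteq> carrier E" by blast
    assume "x \<in> G \<inter> H"
    then obtain Q \<epsilon> \<delta> R \<epsilon>' \<delta>' where
      Q: "finite Q" "Q \<subseteq> P" "0 < \<epsilon>" "0 < \<delta>" "\<delta> < 1" "x <+\<^bsub>E\<^esub> nbhd_eps_lambda M E Q \<epsilon> \<delta> \<subseteq> G" and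
      R: "finite R" "R \<subseteq> P" "0 < \<epsilon>'" "0 < \<delta>'" "\<delta>' < 1" "x <+\<^bsub>E\<^esub> nbhd_eps_lambda M E R \<epsilon>' \<delta>' \<subseteq> H"
      using G H by (metis IntD1 IntD2)
    have "x <+\<^bsub>E\<^esub> nbhd_eps_lambda M E (Q \<union> R) (min \<epsilon> \<epsilon>') (min \<delta> \<delta>') \<subseteq> G \<inter> H"
      using Q R mono[of "Q \<union> R" Q "min \<epsilon> \<epsilon>'" \<epsilon> "min \<delta> \<delta>'" \<delta>]
        mono[of "Q \<union> R" R "min \<epsilon> \<epsilon>'" \<epsilon>' "min \<delta> \<delta>'" \<delta>']
      unfolding a_l_coset_def' by (simp add: subset_eq) blast
    then show "\<exists>Q \<epsilon> \<delta>. finite Q \<and> Q \<subseteq> P \<and> 0 < \<epsilon> \<and> 0 < \<delta> \<and> \<delta> < 1 \<and>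
        x <+\<^bsub>E\<^esub> nbhd_eps_lambda M E Q \<epsilon> \<delta> \<subseteq> G \<inter> H"
      using Q R by (intro exI[of _ "Q \<union> R"] exI[of _ "min \<epsilon> \<epsilon>'"] exI[of _ "min \<delta> \<delta>'"]) auto
  next
    fix \<K> x assume \<K>: "\<forall>G\<in>\<K>. G \<subseteq> carrier E \<and> (\<forall>x\<in>G. \<exists>Q \<epsilon> \<delta>. finite Q \<and> Q \<subseteq> P \<and> 0 < \<epsilon> \<and>
        0 < \<delta> \<and> \<delta> < 1 \<and> x <+\<^bsub>E\<^esub> nbhd_eps_lambda M E Q \<epsilon> \<delta> \<subseteq> G)"
    then show "\<Union>\<K> \<subseteq> carrier E" by blast
    assume "x \<in> \<Union>\<K>"
    then obtain G where "G \<in> \<K>" "x \<in> G" by blast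
    with \<K> show "\<exists>Q \<epsilon> \<delta>. finite Q \<and> Q \<subseteq> P \<and> 0 < \<epsilon> \<and> 0 < \<delta> \<and> \<delta> < 1 \<and>
        x <+\<^bsub>E\<^esub> nbhd_eps_lambda M E Q \<epsilon> \<delta> \<subseteq> \<Union>\<K>"
      by (meson Union_upper order_trans)
  qed simp
qed

lemma openin_T_c:
  "openin (T_c M E P) G \<longleftrightarrow> G \<subseteq> carrier E \<and>
     (\<forall>x\<in>G. \<exists>Q \<epsilon>. finite Q \<and> Q \<subseteq> P \<and> \<epsilon> \<in> L0_pp M \<and> x <+\<^bsub>E\<^esub> nbhd_c M E Q \<epsilon> \<subseteq> G)"
proof -
  have mono: "nbhd_c M E Q \<epsilon> \<subseteq> nbhd_c M E R \<epsilon>'"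
    if "finite Q" "Q \<subseteq> P" "R \<subseteq> Q" "L0_le M \<epsilon> \<epsilon>'" for Q R \<epsilon> \<epsilon>'
  proof
    fix y assume "y \<in> nbhd_c M E Q \<epsilon>"
    then have y: "y \<in> carrier E" "L0_le M (sup_norm M Q y) \<epsilon>" by (auto simp: nbhd_c_def)
    have "L0_le M (sup_norm M R y) \<epsilon>'"
      using sup_norm_mono(2)[OF that(1-3) y(1)] y(2) that(4) unfolding L0_le_def
      by eventually_elim simp
    with y show "y \<in> nbhd_c M E R \<epsilon>'" by (auto simp: nbhd_c_def)
  qed
  have min: "\<exists>\<mu>\<in>L0_pp M. L0_le M \<mu> \<epsilon> \<and> L0_le M \<mu> \<eta>" if "\<epsilon> \<in> L0_pp M" "\<eta> \<in> L0_pp M" for \<epsilon> \<eta>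
  proof -
    have [measurable]: "L0_rep \<epsilon> \<in> borel_measurable M" "L0_rep \<eta> \<in> borel_measurable M"
      using that by (auto simp: L0_pp_def L0_plus_iff L0_rep_measurable)
    let ?\<mu> = "L0_class M (\<lambda>w. min (L0_rep \<epsilon> w) (L0_rep \<eta> w))"
    have rep: "AE w in M. L0_rep ?\<mu> w = min (L0_rep \<epsilon> w) (L0_rep \<eta> w)"
      by (rule L0_rep_class) measurable
    have in_L0: "?\<mu> \<in> L0 M" by (rule L0_class_in) measurable
    have "AE w in M. 0 < L0_rep \<epsilon> w" "AE w in M. 0 < L0_rep \<eta> w"
      using that by (auto simp: L0_pp_def)
    with rep have pos: "AE w in M. 0 < L0_rep ?\<mu> w" by eventually_elim simp
    then have "AE w in M. 0 \<le> L0_rep ?\<mu> w" by eventually_elim simp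
    with pos in_L0 have "?\<mu> \<in> L0_pp M" by (auto simp: L0_pp_def L0_plus_iff)
    moreover have "L0_le M ?\<mu> \<epsilon>" using rep unfolding L0_le_def by eventually_elim simp
    moreover have "L0_le M ?\<mu> \<eta>" using rep unfolding L0_le_def by eventually_elim simp
    ultimately show ?thesis by blast
  qed
  show ?thesis
    unfolding T_c_def
  proof (subst topology_inverse', unfold istopology_def, intro conjI allI impI ballI)
    fix G H x
    assume G: "G \<subseteq> carrier E \<and> (\<forall>x\<in>G. \<exists>Q \<epsilon>. finite Q \<and> Q \<subseteq> P \<and> \<epsilon> \<in> L0_pp M \<and>
        x <+\<^bsub>E\<^esub> nbhd_c M E Q \<epsilon> \<subseteq> G)"
      and H: "H \<subseteq> carrier E \<and> (\<forall>x\<in>H. \<exists>Q \<epsilon>. finite Q \<and> Q \<subseteq> P \<and> \<epsilon> \<in> L0_pp M \<and>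
        x <+\<^bsub>E\<^esub> nbhd_c M E Q \<epsilon> \<subseteq> H)"
    then show "G \<inter> H \<subseteq> carrier E" by blast
    assume "x \<in> G \<inter> H"
    then obtain Q \<epsilon> R \<epsilon>' where
      Q: "finite Q" "Q \<subseteq> P" "\<epsilon> \<in> L0_pp M" "x <+\<^bsub>E\<^esub> nbhd_c M E Q \<epsilon> \<subseteq> G" and
      R: "finite R" "R \<subseteq> P" "\<epsilon>' \<in> L0_pp M" "x <+\<^bsub>E\<^esub> nbhd_c M E R \<epsilon>' \<subseteq> H"
      using G H by (metis IntD1 IntD2)
    obtain \<mu> where \<mu>: "\<mu> \<in> L0_pp M" "L0_le M \<mu> \<epsilon>" "L0_le M \<mu> \<epsilon>'" using min Q(3) R(3) by blast
    have "x <+\<^bsub>E\<^esub> nbhd_c M E (Q \<union> R) \<mu> \<subseteq> G \<inter> H"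
      using Q R \<mu> mono[of "Q \<union> R" Q \<mu> \<epsilon>] mono[of "Q \<union> R" R \<mu> \<epsilon>']
      unfolding a_l_coset_def' by (simp add: subset_eq) blast
    then show "\<exists>Q \<epsilon>. finite Q \<and> Q \<subseteq> P \<and> \<epsilon> \<in> L0_pp M \<and> x <+\<^bsub>E\<^esub> nbhd_c M E Q \<epsilon> \<subseteq> G \<inter> H"
      using Q R \<mu> by (intro exI[of _ "Q \<union> R"] exI[of _ \<mu>]) auto
  next
    fix \<K> x assume \<K>: "\<forall>G\<in>\<K>. G \<subseteq> carrier E \<and> (\<forall>x\<in>G. \<exists>Q \<epsilon>. finite Q \<and> Q \<subseteq> P \<and>
        \<epsilon> \<in> L0_pp M \<and> x <+\<^bsub>E\<^esub> nbhd_c M E Q \<epsilon> \<subseteq> G)"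
    then show "\<Union>\<K> \<subseteq> carrier E" by blast
    assume "x \<in> \<Union>\<K>"
    then obtain G where "G \<in> \<K>" "x \<in> G" by blast
    with \<K> show "\<exists>Q \<epsilon>. finite Q \<and> Q \<subseteq> P \<and> \<epsilon> \<in> L0_pp M \<and> x <+\<^bsub>E\<^esub> nbhd_c M E Q \<epsilon> \<subseteq> \<Union>\<K>"
      by (meson Union_upper order_trans)
  qed simp
qed

end

end

theory Submission
  imports Defs
begin

text \<open>
  The topology \<open>T_c\<close> is finer than \<open>T_eps_lambda\<close> and has a local base of sets that are closed under
  limits in probability, so a \<open>T_c\<close>-Cauchy net converges in \<open>T_c\<close> to its \<open>T_eps_lambda\<close>-limit.

  For the converse, a \<open>T_eps_lambda\<close>-Cauchy net need not be \<open>T_c\<close>-Cauchy. It is replaced by a net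
  indexed by the pairs \<open>(Q, g)\<close> of a finite subfamily and a positive random variable: its term at
  \<open>(Q, g)\<close> is a point that is eventually, in probability, within \<open>g\<close> of the given net with respect
  to \<open>Q\<close>. Such points exist by countable concatenation. Two of them are within \<open>2g\<close> of each other
  almost surely, so the new net is \<open>T_c\<close>-Cauchy, and its \<open>T_c\<close>-limit is the \<open>T_eps_lambda\<close>-limit of
  the given net.
\<close>

section \<open>Nets in translation-invariant topologies\<close>

context abelian_group
begin

lemma minus_add_minus:
  assumes "a \<in> carrier G" "b \<in> carrier G" "c \<in> carrier G"
  shows "(a \<ominus> b) \<oplus> (b \<ominus> c) = a \<ominus> c"
  using assms by (simp add: a_minus_def a_assoc r_neg1)

lemma minus_minus_swap:
  assumes "a \<in> carrier G" "b \<in> carrier G"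
  shows "\<ominus> (a \<ominus> b) = b \<ominus> a"
  using assms by (simp add: a_minus_def minus_add a_comm)

lemma add_minus_cancel:
  assumes "a \<in> carrier G" "b \<in> carrier G"
  shows "a \<oplus> (b \<ominus> a) = b" "(a \<oplus> b) \<ominus> a = b"
proof -
  show "a \<oplus> (b \<ominus> a) = b" using assms by (simp add: a_minus_def a_lcomm[of a b] r_neg)
  show "(a \<oplus> b) \<ominus> a = b" using assms by (simp add: a_minus_def a_comm[of a b] a_assoc r_neg)
qed

end

text \<open>Common setting for both topologies, so that nets are reduced to basic neighbourhoods
  only once. The members of \<open>\<B>\<close> need not be open; \<open>base_add\<close> ensures
  that each still contains an open neighbourhood of zero.\<close>

locale translation_invariant_topology = abelian_group G for G (structure) +
  fixes T :: "'a topology" and \<B> :: "'a set set"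
  assumes openin_iff: "\<And>U. openin T U \<longleftrightarrow> U \<subseteq> carrier G \<and> (\<forall>x\<in>U. \<exists>N\<in>\<B>. x <+ N \<subseteq> U)"
    and base_carrier: "\<And>N. N \<in> \<B> \<Longrightarrow> N \<subseteq> carrier G"
    and base_zero: "\<And>N. N \<in> \<B> \<Longrightarrow> \<zero> \<in> N"
    and base_add: "\<And>N. N \<in> \<B> \<Longrightarrow> \<exists>N'\<in>\<B>. \<forall>a\<in>N'. \<forall>b\<in>N'. a \<oplus> b \<in> N"
    and base_nonempty: "\<B> \<noteq> {}"
begin

lemma topspace_eq_carrier: "topspace T = carrier G"
proof -
  have "openin T (carrier G)"
    using base_nonempty base_carrier by (auto simp: openin_iff a_l_coset_def' subset_eq)
  then show ?thesis
    using openin_topspace[of T] openin_subset[of T "carrier G"] unfolding openin_iff by blast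
qed

text \<open>The open set is the interior of \<open>x <+ N\<close>, built by hand as the set of
  points \<open>z\<close> having some basic translate inside \<open>x <+ N\<close>. A neighbourhood
  \<open>N''\<close> with \<open>N'' + N''\<close> inside \<open>N'\<close> shows that it is open,
  and zero lying in every basic set shows that it is contained in \<open>x <+ N\<close>.\<close>

lemma open_inside_translate:
  assumes N: "N \<in> \<B>" and x: "x \<in> carrier G"
  shows "\<exists>U. openin T U \<and> x \<in> U \<and> U \<subseteq> x <+ N"
proof -
  define U where "U = {z \<in> carrier G. \<exists>N'\<in>\<B>. z <+ N' \<subseteq> x <+ N}"
  have "openin T U"
    unfolding openin_iff
  proof (intro conjI ballI)
    show "U \<subseteq> carrier G" by (auto simp: U_def)
    fix z assume "z \<in> U"
    then obtain N' where z: "z \<in> carrier G" "N' \<in> \<B>" "z <+ N' \<subseteq> x <+ N"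
      by (auto simp: U_def)
    obtain N'' where N'': "N'' \<in> \<B>" "\<And>a b. a \<in> N'' \<Longrightarrow> b \<in> N'' \<Longrightarrow> a \<oplus> b \<in> N'"
      using base_add[OF z(2)] by blast
    have "z \<oplus> a \<in> U" if a: "a \<in> N''" for a
    proof -
      have "(z \<oplus> a) <+ N'' \<subseteq> z <+ N'"
        using N'' a z(1) base_carrier[OF N''(1)] by (auto simp: a_l_coset_def' subset_eq a_assoc)
      then show ?thesis
        using z N'' a base_carrier[OF N''(1)] unfolding U_def by blast
    qed
    then show "\<exists>N\<in>\<B>. z <+ N \<subseteq> U"
      using N''(1) by (auto simp: a_l_coset_def')
  qed
  moreover have "x \<in> U" using x N by (auto simp: U_def)
  moreover have "U \<subseteq> x <+ N"
  proof
    fix z assume "z \<in> U"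
    then obtain N' where z: "z \<in> carrier G" "N' \<in> \<B>" "z <+ N' \<subseteq> x <+ N"
      by (auto simp: U_def)
    have "z \<oplus> \<zero> \<in> z <+ N'" using base_zero[OF z(2)] by (auto simp: a_l_coset_def')
    with z show "z \<in> x <+ N" by auto
  qed
  ultimately show ?thesis by blast
qed

text \<open>From left to right the interior of \<open>l <+ N\<close> is needed as a test set, since
  \<open>l <+ N\<close> itself may fail to be open; the other direction unfolds the description of
  open sets.\<close>

lemma net_converges_iff_base:
  assumes x: "x ` I \<subseteq> carrier G"
  shows "net_converges T I r x l \<longleftrightarrow> l \<in> carrier G \<and>
           (\<forall>N\<in>\<B>. \<exists>i\<in>I. \<forall>j\<in>I. (i, j) \<in> r \<longrightarrow> x j \<ominus> l \<in> N)"
proof (intro iffI conjI ballI)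
  assume c: "net_converges T I r x l"
  then show l: "l \<in> carrier G" by (simp add: net_converges_def topspace_eq_carrier)
  fix N assume N: "N \<in> \<B>"
  obtain U where U: "openin T U" "l \<in> U" "U \<subseteq> l <+ N" using open_inside_translate[OF N l] by blast
  have N': "z \<ominus> l \<in> N" if "z \<in> l <+ N" for z
    proof -
    from that obtain a where "a \<in> N" "z = l \<oplus> a" by (auto simp: a_l_coset_def')
    then show ?thesis using add_minus_cancel(2)[OF l] base_carrier[OF N] by auto
  qed
  obtain i where "i \<in> I" "\<forall>j\<in>I. (i, j) \<in> r \<longrightarrow> x j \<in> U"
    using c U unfolding net_converges_def by blast
  with N' U(3) show "\<exists>i\<in>I. \<forall>j\<in>I. (i, j) \<in> r \<longrightarrow> x j \<ominus> l \<in> N" by blast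
next
  assume *: "l \<in> carrier G \<and> (\<forall>N\<in>\<B>. \<exists>i\<in>I. \<forall>j\<in>I. (i, j) \<in> r \<longrightarrow> x j \<ominus> l \<in> N)"
  show "net_converges T I r x l"
    unfolding net_converges_def
  proof (intro conjI allI impI)
    show "l \<in> topspace T" using * by (simp add: topspace_eq_carrier)
    fix U assume U: "openin T U \<and> l \<in> U"
    then obtain N where N: "N \<in> \<B>" "l <+ N \<subseteq> U" unfolding openin_iff by blast
    then obtain i where i: "i \<in> I" "\<And>j. j \<in> I \<Longrightarrow> (i, j) \<in> r \<Longrightarrow> x j \<ominus> l \<in> N" using * by blast
    have "x j \<in> U" if "j \<in> I" "(i, j) \<in> r" for j
    proof -
      have "x j \<in> carrier G" using x that by blast
      then have "l \<oplus> (x j \<ominus> l) = x j" using * by (intro add_minus_cancel) auto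
      moreover have "l \<oplus> (x j \<ominus> l) \<in> U" using i(2)[OF that] N(2) by (auto simp: a_l_coset_def')
      ultimately show ?thesis by simp
    qed
    with i(1) show "\<exists>i\<in>I. \<forall>j\<in>I. (i, j) \<in> r \<longrightarrow> x j \<in> U" by blast
  qed
qed

text \<open>The open neighbourhoods of zero and the members of \<open>\<B>\<close> are cofinal in
  each other, which is what \<open>inner\<close> and \<open>outer\<close> record.\<close>

lemma Cauchy_net_iff_base:
  "Cauchy_net G T I r x \<longleftrightarrow> x ` I \<subseteq> carrier G \<and>
     (\<forall>N\<in>\<B>. \<exists>i\<in>I. \<forall>j\<in>I. \<forall>k\<in>I. (i, j) \<in> r \<and> (i, k) \<in> r \<longrightarrow> x j \<ominus> x k \<in> N)"
proof -
  have zero_coset: "\<zero> <+ N = N" if "N \<in> \<B>" for N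
    using base_carrier[OF that] by (auto simp: a_l_coset_def' subset_eq)
  have inner: "\<exists>U. openin T U \<and> \<zero> \<in> U \<and> U \<subseteq> N" if "N \<in> \<B>" for N
    using open_inside_translate[OF that zero_closed] zero_coset[OF that] by simp
  have outer: "\<exists>N\<in>\<B>. N \<subseteq> U" if U: "openin T U" "\<zero> \<in> U" for U
  proof -
    obtain N where "N \<in> \<B>" "\<zero> <+ N \<subseteq> U" using U unfolding openin_iff by blast
    then show ?thesis using zero_coset by auto
  qed
  show ?thesis
    unfolding Cauchy_net_def
  proof (intro conj_cong refl iffI ballI allI impI)
    fix N assume *: "\<forall>U. openin T U \<and> \<zero> \<in> U \<longrightarrow>
        (\<exists>i\<in>I. \<forall>j\<in>I. \<forall>k\<in>I. (i, j) \<in> r \<and> (i, k) \<in> r \<longrightarrow> x j \<ominus> x k \<in> U)"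
      and N: "N \<in> \<B>"
    obtain U where U: "openin T U" "\<zero> \<in> U" "U \<subseteq> N" using inner[OF N] by blast
    then obtain i where "i \<in> I" "\<forall>j\<in>I. \<forall>k\<in>I. (i, j) \<in> r \<and> (i, k) \<in> r \<longrightarrow> x j \<ominus> x k \<in> U"
      using *[rule_format, of U] by auto
    with U(3) show "\<exists>i\<in>I. \<forall>j\<in>I. \<forall>k\<in>I. (i, j) \<in> r \<and> (i, k) \<in> r \<longrightarrow> x j \<ominus> x k \<in> N"
      by blast
  next
    fix U assume *: "\<forall>N\<in>\<B>. \<exists>i\<in>I. \<forall>j\<in>I. \<forall>k\<in>I. (i, j) \<in> r \<and> (i, k) \<in> r \<longrightarrow> x j \<ominus> x k \<in> N"
      and U: "openin T U \<and> \<zero> \<in> U"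
    obtain N where N: "N \<in> \<B>" "N \<subseteq> U" using outer U by blast
    obtain i where "i \<in> I" "\<forall>j\<in>I. \<forall>k\<in>I. (i, j) \<in> r \<and> (i, k) \<in> r \<longrightarrow> x j \<ominus> x k \<in> N"
      using bspec[OF * N(1)] by (elim bexE)
    with N(2) show "\<exists>i\<in>I. \<forall>j\<in>I. \<forall>k\<in>I. (i, j) \<in> r \<and> (i, k) \<in> r \<longrightarrow> x j \<ominus> x k \<in> U"
      by blast
  qed
qed

end

section \<open>Almost sure and stochastic inequalities\<close>

context prob_space
begin

text \<open>Yields an almost sure bound from estimates in probability: each event where
  \<open>h\<close> exceeds \<open>f\<close> by at least \<open>1/(n+1)\<close> is null, and there
  are countably many of them.\<close>

lemma AE_le_if_prob_small:
  fixes f h :: "'a \<Rightarrow> real"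
  assumes [measurable]: "f \<in> borel_measurable M" "h \<in> borel_measurable M"
    and small: "\<And>e. e > 0 \<Longrightarrow> prob {w \<in> space M. f w + e \<le> h w} \<le> e"
  shows "AE w in M. h w \<le> f w"
proof -
  have *: "AE w in M. h w < f w + inverse (real (Suc n))" for n
  proof -
    let ?c = "inverse (real (Suc n))"
    \<comment> \<open>In \<open>small\<close> the same number is margin and probability bound.
      Lowering the margin from \<open>?c\<close> to \<open>min e ?c\<close> only enlarges the event
      and brings its bound down to \<open>e\<close>.\<close>
    have "prob {w \<in> space M. f w + ?c \<le> h w} \<le> 0 + e" if "e > 0" for e
    proof -
      have "prob {w \<in> space M. f w + ?c \<le> h w} \<le> prob {w \<in> space M. f w + min e ?c \<le> h w}"
        by (rule finite_measure_mono) auto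
      also have "\<dots> \<le> min e ?c" using that by (intro small) auto
      finally show ?thesis by simp
    qed
    then have "prob {w \<in> space M. f w + ?c \<le> h w} \<le> 0" by (rule field_le_epsilon)
    then have "prob {w \<in> space M. f w + ?c \<le> h w} = 0" using measure_nonneg by (rule antisym)
    then have "AE w in M. w \<notin> {w \<in> space M. f w + ?c \<le> h w}" by (subst (asm) prob_eq_0) measurable
    with AE_space show ?thesis by eventually_elim auto
  qed
  have "AE w in M. \<forall>n. h w < f w + inverse (real (Suc n))"
    unfolding AE_all_countable using * by (rule allI)
  then show ?thesis
  proof eventually_elim
    case (elim w)
    show ?case
    proof (rule ccontr)
      assume "\<not> h w \<le> f w"
      then obtain n where "inverse (real (Suc n)) < h w - f w" using reals_Archimedean[of "h w - f w"] by auto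
      with elim[rule_format, of n] show False by simp
    qed
  qed
qed

lemma prob_union_bound_AE:
  assumes "AE w in M. Q w \<longrightarrow> R w \<or> S w"
    and [measurable]: "Measurable.pred M Q" "Measurable.pred M R" "Measurable.pred M S"
  shows "prob {w \<in> space M. Q w} \<le> prob {w \<in> space M. R w} + prob {w \<in> space M. S w}"
proof -
  have "prob {w \<in> space M. Q w} \<le> prob ({w \<in> space M. R w} \<union> {w \<in> space M. S w})"
  proof (rule finite_measure_mono_AE)
    show "AE w in M. w \<in> {w \<in> space M. Q w} \<longrightarrow> w \<in> {w \<in> space M. R w} \<union> {w \<in> space M. S w}"
      using assms(1) by eventually_elim auto
  qed auto
  also have "\<dots> \<le> prob {w \<in> space M. R w} + prob {w \<in> space M. S w}"
    by (rule measure_Un_le) auto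
  finally show ?thesis .
qed

end

section \<open>The seminorms of finite subfamilies\<close>

context
  fixes M :: "'w measure"
    and E :: "(('w \<Rightarrow> 'k::{real_normed_field,euclidean_space}) set, 'e) module"
    and P :: "('e \<Rightarrow> ('w \<Rightarrow> real) set) set"
  assumes rlcm: "random_locally_convex_module M E P"
begin

interpretation prob_space M
  using rlcm by (simp add: random_locally_convex_module_def)

interpretation E: Module.module "L0_ring M" E
  using rlcm by (simp add: random_locally_convex_module_def)

text \<open>Passing to a representative turns inequalities between classes into almost sure
  inequalities between functions, to which \<open>eventually_elim\<close> applies.\<close>

abbreviation seminorm_rep :: "('e \<Rightarrow> ('w \<Rightarrow> real) set) set \<Rightarrow> 'e \<Rightarrow> 'w \<Rightarrow> real" where
  "seminorm_rep Q y \<equiv> L0_rep (sup_norm M Q y)"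

lemma L0_seminorm_mem: "p \<in> P \<Longrightarrow> L0_seminorm M E p"
  using rlcm by (simp add: random_locally_convex_module_def)

lemma seminorm_in_L0_plus: "p \<in> P \<Longrightarrow> x \<in> carrier E \<Longrightarrow> p x \<in> L0_plus M"
  using L0_seminorm_mem by (auto simp: L0_seminorm_def)

lemma seminorm_rep_measurable [measurable (raw)]:
  assumes "finite Q" "Q \<subseteq> P" "y \<in> carrier E"
  shows "seminorm_rep Q y \<in> borel_measurable M"
  using sup_norm_mono(1)[OF rlcm assms(1,2) order_refl assms(3)]
  by (simp add: L0_plus_iff L0_rep_measurable)

lemma seminorm_rep_nonneg:
  assumes "finite Q" "Q \<subseteq> P" "y \<in> carrier E"
  shows "AE w in M. 0 \<le> seminorm_rep Q y w"
  using sup_norm_mono(1)[OF rlcm assms(1,2) order_refl assms(3)] by (simp add: L0_plus_iff)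

lemma seminorm_rep_mono:
  assumes "finite Q" "Q \<subseteq> P" "R \<subseteq> Q" "y \<in> carrier E"
  shows "AE w in M. seminorm_rep R y w \<le> seminorm_rep Q y w"
  using sup_norm_mono(2)[OF rlcm assms] by (simp add: L0_le_def)

lemma least_sup_norm:
  assumes "finite Q" "Q \<subseteq> P" "y \<in> carrier E"
  shows "least (L0_order M) (sup_norm M Q y) (Upper (L0_order M) ((\<lambda>p. p y) ` Q))"
  unfolding sup_norm_def using assms seminorm_in_L0_plus by (intro L0_order_finite_sup) auto

lemma seminorm_le_seminorm_rep:
  assumes "finite Q" "Q \<subseteq> P" "y \<in> carrier E" "p \<in> Q"
  shows "AE w in M. L0_rep (p y) w \<le> seminorm_rep Q y w"
  using least_sup_norm[OF assms(1-3)] assms seminorm_in_L0_plus[of p y]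
  by (auto simp: least_def Upper_def L0_order_def L0_le_def)

text \<open>The class of \<open>u\<close> is an upper bound in \<open>L0_plus\<close>, hence above
  the supremum. The assumption \<open>nonneg\<close> places it in that ordered set and also settles
  the case of empty \<open>Q\<close>, where the supremum is 0.\<close>

lemma seminorm_rep_le:
  assumes Q: "finite Q" "Q \<subseteq> P" "y \<in> carrier E" and u: "u \<in> borel_measurable M"
    and nonneg: "AE w in M. 0 \<le> u w" and le: "\<And>p. p \<in> Q \<Longrightarrow> AE w in M. L0_rep (p y) w \<le> u w"
  shows "AE w in M. seminorm_rep Q y w \<le> u w"
proof -
  have rep: "AE w in M. L0_rep (L0_class M u) w = u w" using u by (rule L0_rep_class)
  have "AE w in M. 0 \<le> L0_rep (L0_class M u) w" using rep nonneg by eventually_elim simp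
  then have "L0_class M u \<in> L0_plus M" using u by (simp add: L0_plus_iff L0_class_in)
  moreover have "L0_le M (p y) (L0_class M u)" if "p \<in> Q" for p
    using le[OF that] rep unfolding L0_le_def by eventually_elim simp
  ultimately have "L0_class M u \<in> Upper (L0_order M) ((\<lambda>p. p y) ` Q)"
    by (auto simp: Upper_def L0_order_def)
  with least_sup_norm[OF Q] have "L0_le M (sup_norm M Q y) (L0_class M u)"
    by (auto simp: least_def L0_order_def)
  with rep show ?thesis unfolding L0_le_def by eventually_elim simp
qed

lemma seminorm_rep_add:
  assumes Q: "finite Q" "Q \<subseteq> P" and x: "x \<in> carrier E" and y: "y \<in> carrier E"
  shows "AE w in M. seminorm_rep Q (x \<oplus>\<^bsub>E\<^esub> y) w \<le> seminorm_rep Q x w + seminorm_rep Q y w"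
proof (rule seminorm_rep_le[OF Q])
  show "x \<oplus>\<^bsub>E\<^esub> y \<in> carrier E" using x y by simp
  show "(\<lambda>w. seminorm_rep Q x w + seminorm_rep Q y w) \<in> borel_measurable M"
    using Q x y by measurable
  show "AE w in M. 0 \<le> seminorm_rep Q x w + seminorm_rep Q y w"
    using seminorm_rep_nonneg[OF Q x] seminorm_rep_nonneg[OF Q y] by eventually_elim simp
  fix p assume p: "p \<in> Q"
  then have "p \<in> P" using Q by blast
  then have "L0_le M (p (x \<oplus>\<^bsub>E\<^esub> y)) (p x \<oplus>\<^bsub>L0_ring M\<^esub> p y)"
    using L0_seminorm_mem x y by (auto simp: L0_seminorm_def)
  moreover have "AE w in M. L0_rep (p x \<oplus>\<^bsub>L0_ring M\<^esub> p y) w = L0_rep (p x) w + L0_rep (p y) w"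
    using seminorm_in_L0_plus[OF \<open>p \<in> P\<close> x] seminorm_in_L0_plus[OF \<open>p \<in> P\<close> y]
    unfolding L0_ring_def
    by (auto intro!: L0_rep_class borel_measurable_add L0_rep_measurable simp: L0_plus_iff)
  ultimately show "AE w in M. L0_rep (p (x \<oplus>\<^bsub>E\<^esub> y)) w \<le> seminorm_rep Q x w + seminorm_rep Q y w"
    using seminorm_le_seminorm_rep[OF Q x p] seminorm_le_seminorm_rep[OF Q y p]
    unfolding L0_le_def by eventually_elim simp
qed

lemma seminorm_smult:
  assumes "p \<in> P" "\<xi> \<in> L0 M" "x \<in> carrier E"
  shows "AE w in M. L0_rep (p (\<xi> \<odot>\<^bsub>E\<^esub> x)) w = norm (L0_rep \<xi> w) * L0_rep (p x) w"
proof -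
  have [measurable]: "L0_rep \<xi> \<in> borel_measurable M" "L0_rep (p x) \<in> borel_measurable M"
    using assms seminorm_in_L0_plus by (auto simp: L0_plus_iff L0_rep_measurable)
  have abs_in: "L0_abs M \<xi> \<in> L0 M" unfolding L0_abs_def by (rule L0_class_in) measurable
  have [measurable]: "L0_rep (L0_abs M \<xi>) \<in> borel_measurable M" using abs_in by (rule L0_rep_measurable)
  have "AE w in M. L0_rep (L0_abs M \<xi>) w = norm (L0_rep \<xi> w)"
    unfolding L0_abs_def by (rule L0_rep_class) measurable
  moreover have "AE w in M. L0_rep (L0_abs M \<xi> \<otimes>\<^bsub>L0_ring M\<^esub> p x) w = L0_rep (L0_abs M \<xi>) w * L0_rep (p x) w"
    unfolding L0_ring_def by (auto intro!: L0_rep_class)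
  ultimately have "AE w in M. L0_rep (L0_abs M \<xi> \<otimes>\<^bsub>L0_ring M\<^esub> p x) w = norm (L0_rep \<xi> w) * L0_rep (p x) w"
    by eventually_elim simp
  moreover have "p (\<xi> \<odot>\<^bsub>E\<^esub> x) = L0_abs M \<xi> \<otimes>\<^bsub>L0_ring M\<^esub> p x"
    using assms L0_seminorm_mem by (auto simp: L0_seminorm_def)
  ultimately show ?thesis by simp
qed

lemma seminorm_rep_smult_le:
  assumes Q: "finite Q" "Q \<subseteq> P" and \<xi>: "\<xi> \<in> L0 M" and x: "x \<in> carrier E"
  shows "AE w in M. seminorm_rep Q (\<xi> \<odot>\<^bsub>E\<^esub> x) w \<le> norm (L0_rep \<xi> w) * seminorm_rep Q x w"
proof (rule seminorm_rep_le[OF Q])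
  have [measurable]: "L0_rep \<xi> \<in> borel_measurable M" using \<xi> by (rule L0_rep_measurable)
  show "\<xi> \<odot>\<^bsub>E\<^esub> x \<in> carrier E" using x \<xi> by (simp add: L0_ring_def)
  show "(\<lambda>w. norm (L0_rep \<xi> w) * seminorm_rep Q x w) \<in> borel_measurable M"
    using Q x by measurable
  show "AE w in M. 0 \<le> norm (L0_rep \<xi> w) * seminorm_rep Q x w"
    using seminorm_rep_nonneg[OF Q x] by eventually_elim simp
  fix p assume p: "p \<in> Q"
  then have "p \<in> P" using Q by blast
  from seminorm_smult[OF this \<xi> x] seminorm_le_seminorm_rep[OF Q x p]
  show "AE w in M. L0_rep (p (\<xi> \<odot>\<^bsub>E\<^esub> x)) w \<le> norm (L0_rep \<xi> w) * seminorm_rep Q x w"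
    by eventually_elim (simp add: mult_left_mono)
qed

lemma seminorm_rep_zero:
  assumes Q: "finite Q" "Q \<subseteq> P"
  shows "AE w in M. seminorm_rep Q \<zero>\<^bsub>E\<^esub> w = 0"
proof -
  have z: "\<zero>\<^bsub>L0_ring M\<^esub> \<in> (L0 M :: ('w \<Rightarrow> 'k) set set)"
    using E.R.zero_closed by (simp add: L0_ring_def)
  have "AE w in M. L0_rep \<zero>\<^bsub>L0_ring M\<^esub> w = (0 :: 'k)"
    by (auto simp: L0_ring_def intro!: L0_rep_class)
  then show ?thesis
    using seminorm_rep_smult_le[OF Q z E.zero_closed] seminorm_rep_nonneg[OF Q E.zero_closed]
    by eventually_elim (simp add: E.smult_l_null)
qed

text \<open>Negation is multiplication by minus one, whose absolute value is 1 almost surely. This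
  gives one inequality, and applying it to the negative of \<open>x\<close> gives the other.\<close>

lemma seminorm_rep_uminus:
  assumes Q: "finite Q" "Q \<subseteq> P" and x: "x \<in> carrier E"
  shows "AE w in M. seminorm_rep Q (\<ominus>\<^bsub>E\<^esub> x) w = seminorm_rep Q x w"
proof -
  let ?R = "L0_ring M :: ('w \<Rightarrow> 'k) set ring"
  let ?m = "\<ominus>\<^bsub>?R\<^esub> \<one>\<^bsub>?R\<^esub>"
  have m: "?m \<in> L0 M" using E.R.a_inv_closed[OF E.R.one_closed] by (simp add: L0_ring_def)
  have one: "\<one>\<^bsub>?R\<^esub> \<in> L0 M" using E.R.one_closed by (simp add: L0_ring_def)
  have [measurable]: "L0_rep ?m \<in> borel_measurable M" "L0_rep \<one>\<^bsub>?R\<^esub> \<in> borel_measurable M"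
    using m one L0_rep_measurable by auto
  \<comment> \<open>The additive inverse of the ring comes without a formula, so the values of
    \<open>?m\<close> are recovered from the equation that its sum with one is zero.\<close>
  have "?m \<oplus>\<^bsub>?R\<^esub> \<one>\<^bsub>?R\<^esub> = L0_class M (\<lambda>w. L0_rep ?m w + L0_rep \<one>\<^bsub>?R\<^esub> w)"
    by (simp add: L0_ring_def)
  then have "L0_class M (\<lambda>w. L0_rep ?m w + L0_rep \<one>\<^bsub>?R\<^esub> w) = \<zero>\<^bsub>?R\<^esub>"
    using E.R.l_neg[OF E.R.one_closed] by simp
  moreover have "AE w in M. L0_rep (L0_class M (\<lambda>w. L0_rep ?m w + L0_rep \<one>\<^bsub>?R\<^esub> w)) w
      = L0_rep ?m w + L0_rep \<one>\<^bsub>?R\<^esub> w"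
    by (rule L0_rep_class) measurable
  ultimately have "AE w in M. L0_rep \<zero>\<^bsub>?R\<^esub> w = L0_rep ?m w + L0_rep \<one>\<^bsub>?R\<^esub> w" by metis
  moreover have "AE w in M. L0_rep \<zero>\<^bsub>?R\<^esub> w = 0" "AE w in M. L0_rep \<one>\<^bsub>?R\<^esub> w = 1"
    by (auto simp: L0_ring_def intro!: L0_rep_class)
  ultimately have "AE w in M. L0_rep ?m w + 1 = 0" by eventually_elim simp
  then have norm: "AE w in M. norm (L0_rep ?m w) = 1"
    by eventually_elim (simp add: eq_neg_iff_add_eq_0[symmetric])
  have le: "AE w in M. seminorm_rep Q (\<ominus>\<^bsub>E\<^esub> y) w \<le> seminorm_rep Q y w" if y: "y \<in> carrier E" for y
  proof -
    have "\<ominus>\<^bsub>E\<^esub> y = ?m \<odot>\<^bsub>E\<^esub> y" using y by (simp add: E.smult_l_minus E.smult_one)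
    with seminorm_rep_smult_le[OF Q m y]
    have "AE w in M. seminorm_rep Q (\<ominus>\<^bsub>E\<^esub> y) w \<le> norm (L0_rep ?m w) * seminorm_rep Q y w" by simp
    with norm show ?thesis by eventually_elim simp
  qed
  from le[OF x] le[OF E.a_inv_closed[OF x]] show ?thesis
    unfolding E.minus_minus[OF x] by eventually_elim simp
qed

lemma seminorm_rep_minus_commute:
  assumes Q: "finite Q" "Q \<subseteq> P" and x: "x \<in> carrier E" and y: "y \<in> carrier E"
  shows "AE w in M. seminorm_rep Q (x \<ominus>\<^bsub>E\<^esub> y) w = seminorm_rep Q (y \<ominus>\<^bsub>E\<^esub> x) w"
  using seminorm_rep_uminus[OF Q E.minus_closed[OF y x]] by (simp add: E.minus_minus_swap x y)

lemma seminorm_rep_triangle: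
  assumes Q: "finite Q" "Q \<subseteq> P" and x: "x \<in> carrier E" and y: "y \<in> carrier E" and z: "z \<in> carrier E"
  shows "AE w in M. seminorm_rep Q (x \<ominus>\<^bsub>E\<^esub> z) w
           \<le> seminorm_rep Q (x \<ominus>\<^bsub>E\<^esub> y) w + seminorm_rep Q (y \<ominus>\<^bsub>E\<^esub> z) w"
  using seminorm_rep_add[OF Q E.minus_closed[OF x y] E.minus_closed[OF y z]]
  by (simp add: E.minus_add_minus x y z)

text \<open>Locality of the seminorms: multiplying by the class of the indicator of \<open>A\<close>
  leaves \<open>p\<close> unchanged on \<open>A\<close>, while the products for \<open>x\<close> and
  \<open>y\<close> coincide. This carries estimates for the pieces over to a concatenation.\<close>

lemma seminorm_rep_local:
  assumes Q: "finite Q" "Q \<subseteq> P" and x: "x \<in> carrier E" and y: "y \<in> carrier E" and z: "z \<in> carrier E"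
    and A: "A \<in> sets M" and eq: "L0_ind M A \<odot>\<^bsub>E\<^esub> x = L0_ind M A \<odot>\<^bsub>E\<^esub> y"
  shows "AE w in M. w \<in> A \<longrightarrow> seminorm_rep Q (x \<ominus>\<^bsub>E\<^esub> z) w \<le> seminorm_rep Q (y \<ominus>\<^bsub>E\<^esub> z) w"
proof -
  let ?i = "L0_ind M A :: ('w \<Rightarrow> 'k) set"
  \<comment> \<open>Off \<open>A\<close> the bound is the seminorm to be estimated, so
    \<open>seminorm_rep_le\<close>, which asks for a bound on all of the space, yields information
    exactly on \<open>A\<close>.\<close>
  let ?u = "\<lambda>w. if w \<in> A then seminorm_rep Q (y \<ominus>\<^bsub>E\<^esub> z) w else seminorm_rep Q (x \<ominus>\<^bsub>E\<^esub> z) w"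
  have xz: "x \<ominus>\<^bsub>E\<^esub> z \<in> carrier E" and yz: "y \<ominus>\<^bsub>E\<^esub> z \<in> carrier E" using x y z by auto
  have i: "?i \<in> L0 M" unfolding L0_ind_def by (rule L0_class_in) (use A in measurable)
  have rep: "AE w in M. L0_rep ?i w = indicator A w"
    unfolding L0_ind_def by (rule L0_rep_class) (use A in measurable)
  have ic: "?i \<in> carrier (L0_ring M)" using i by (simp add: L0_ring_def)
  have eq': "?i \<odot>\<^bsub>E\<^esub> (x \<ominus>\<^bsub>E\<^esub> z) = ?i \<odot>\<^bsub>E\<^esub> (y \<ominus>\<^bsub>E\<^esub> z)"
    using x y z ic eq by (simp add: a_minus_def E.smult_r_distr)
  have "AE w in M. seminorm_rep Q (x \<ominus>\<^bsub>E\<^esub> z) w \<le> ?u w"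
  proof (rule seminorm_rep_le[OF Q xz])
    show "?u \<in> borel_measurable M" using Q xz yz A by measurable
    show "AE w in M. 0 \<le> ?u w"
      using seminorm_rep_nonneg[OF Q xz] seminorm_rep_nonneg[OF Q yz] by eventually_elim simp
    fix p assume p: "p \<in> Q"
    then have "p \<in> P" using Q by blast
    from seminorm_smult[OF this i xz] seminorm_smult[OF this i yz] rep
      seminorm_le_seminorm_rep[OF Q xz p] seminorm_le_seminorm_rep[OF Q yz p]
    show "AE w in M. L0_rep (p (x \<ominus>\<^bsub>E\<^esub> z)) w \<le> ?u w"
      unfolding eq' by eventually_elim (auto simp: indicator_def split: if_splits)
  qed
  then show ?thesis by eventually_elim (simp split: if_splits)
qed


section \<open>Local bases of the two topologies\<close>

text \<open>The radius is a function and not a class, so that halves and minima of radii can be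
  formed pointwise.\<close>

definition as_nbhd :: "('e \<Rightarrow> ('w \<Rightarrow> real) set) set \<Rightarrow> ('w \<Rightarrow> real) \<Rightarrow> 'e set" where
  "as_nbhd Q g = {y \<in> carrier E. AE w in M. seminorm_rep Q y w \<le> g w}"

text \<open>Neighbourhoods of Ky Fan type: one number serves as threshold and as probability bound.
  Measuring the exceptional event lets errors be added by the union bound.\<close>

definition stoch_nbhd :: "('e \<Rightarrow> ('w \<Rightarrow> real) set) set \<Rightarrow> real \<Rightarrow> 'e set" where
  "stoch_nbhd Q e = {y \<in> carrier E. measure M {w \<in> space M. e \<le> seminorm_rep Q y w} < e}"

text \<open>Used twice: as parameters of the base of \<open>T_c\<close> and as the index set of the
  auxiliary net in the converse direction.\<close>

definition gauges :: "(('e \<Rightarrow> ('w \<Rightarrow> real) set) set \<times> ('w \<Rightarrow> real)) set" where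
  "gauges = {(Q, g). finite Q \<and> Q \<subseteq> P \<and> g \<in> borel_measurable M \<and> (AE w in M. 0 < g w)}"

abbreviation as_nbhds :: "'e set set" where
  "as_nbhds \<equiv> case_prod as_nbhd ` gauges"

abbreviation stoch_nbhds :: "'e set set" where
  "stoch_nbhds \<equiv> {stoch_nbhd Q e |Q e. finite Q \<and> Q \<subseteq> P \<and> 0 < e}"

lemma openin_T_c_iff_as_nbhd:
  "openin (T_c M E P) U \<longleftrightarrow> U \<subseteq> carrier E \<and>
     (\<forall>x\<in>U. \<exists>N\<in>as_nbhds. x <+\<^bsub>E\<^esub> N \<subseteq> U)"
proof -
  have rep: "(Q, L0_rep \<epsilon>) \<in> gauges \<and> nbhd_c M E Q \<epsilon> = as_nbhd Q (L0_rep \<epsilon>)"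
    if "finite Q" "Q \<subseteq> P" "\<epsilon> \<in> L0_pp M" for Q \<epsilon>
    using that
    by (auto simp: gauges_def nbhd_c_def as_nbhd_def L0_le_def L0_pp_def L0_plus_iff L0_rep_measurable)
  have gauge_class: "\<exists>\<epsilon>\<in>L0_pp M. nbhd_c M E Q \<epsilon> = as_nbhd Q g" if "(Q, g) \<in> gauges" for Q g
  proof
    have g: "g \<in> borel_measurable M" "AE w in M. 0 < g w" using that by (auto simp: gauges_def)
    have r: "AE w in M. L0_rep (L0_class M g) w = g w" using g(1) by (rule L0_rep_class)
    have pos: "AE w in M. 0 < L0_rep (L0_class M g) w" using r g(2) by eventually_elim simp
    then have "AE w in M. 0 \<le> L0_rep (L0_class M g) w" by eventually_elim simp
    with pos g(1) show "L0_class M g \<in> L0_pp M" by (simp add: L0_pp_def L0_plus_iff L0_class_in)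
    have "L0_le M (sup_norm M Q y) (L0_class M g) \<longleftrightarrow> (AE w in M. seminorm_rep Q y w \<le> g w)" for y
      unfolding L0_le_def by (rule eventually_subst) (use r in \<open>eventually_elim; simp\<close>)
    then show "nbhd_c M E Q (L0_class M g) = as_nbhd Q g" by (simp add: nbhd_c_def as_nbhd_def)
  qed
  have "(\<exists>Q \<epsilon>. finite Q \<and> Q \<subseteq> P \<and> \<epsilon> \<in> L0_pp M \<and> x <+\<^bsub>E\<^esub> nbhd_c M E Q \<epsilon> \<subseteq> U) \<longleftrightarrow>
      (\<exists>N\<in>as_nbhds. x <+\<^bsub>E\<^esub> N \<subseteq> U)" for x
  proof
    assume "\<exists>Q \<epsilon>. finite Q \<and> Q \<subseteq> P \<and> \<epsilon> \<in> L0_pp M \<and> x <+\<^bsub>E\<^esub> nbhd_c M E Q \<epsilon> \<subseteq> U"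
    then obtain Q \<epsilon> where *: "finite Q" "Q \<subseteq> P" "\<epsilon> \<in> L0_pp M" "x <+\<^bsub>E\<^esub> nbhd_c M E Q \<epsilon> \<subseteq> U" by blast
    with rep[OF *(1-3)] show "\<exists>N\<in>as_nbhds. x <+\<^bsub>E\<^esub> N \<subseteq> U" by force
  next
    assume "\<exists>N\<in>as_nbhds. x <+\<^bsub>E\<^esub> N \<subseteq> U"
    then obtain Q g where *: "(Q, g) \<in> gauges" "x <+\<^bsub>E\<^esub> as_nbhd Q g \<subseteq> U" by auto
    obtain \<epsilon> where "\<epsilon> \<in> L0_pp M" "nbhd_c M E Q \<epsilon> = as_nbhd Q g" using gauge_class[OF *(1)] by blast
    with * have "finite Q \<and> Q \<subseteq> P \<and> \<epsilon> \<in> L0_pp M \<and> x <+\<^bsub>E\<^esub> nbhd_c M E Q \<epsilon> \<subseteq> U"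
      by (simp add: gauges_def)
    then show "\<exists>Q \<epsilon>. finite Q \<and> Q \<subseteq> P \<and> \<epsilon> \<in> L0_pp M \<and> x <+\<^bsub>E\<^esub> nbhd_c M E Q \<epsilon> \<subseteq> U"
      by blast
  qed
  then show ?thesis by (simp only: openin_T_c[OF rlcm])
qed

lemma nbhd_eps_lambda_iff:
  assumes "finite Q" "Q \<subseteq> P"
  shows "nbhd_eps_lambda M E Q \<epsilon> \<delta>
    = {y \<in> carrier E. prob {w \<in> space M. \<epsilon> \<le> seminorm_rep Q y w} < \<delta>}"
proof -
  have "prob {w \<in> space M. seminorm_rep Q y w < \<epsilon>} = 1 - prob {w \<in> space M. \<epsilon> \<le> seminorm_rep Q y w}"
    if y: "y \<in> carrier E" for y
  proof -
    have [measurable]: "seminorm_rep Q y \<in> borel_measurable M" using assms y by measurable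
    have "{w \<in> space M. seminorm_rep Q y w < \<epsilon>} = space M - {w \<in> space M. \<epsilon> \<le> seminorm_rep Q y w}"
      by auto
    then show ?thesis by (simp add: prob_compl)
  qed
  then show ?thesis by (auto simp: nbhd_eps_lambda_def)
qed

lemma openin_T_eps_lambda_iff_stoch_nbhd:
  "openin (T_eps_lambda M E P) U \<longleftrightarrow> U \<subseteq> carrier E \<and>
     (\<forall>x\<in>U. \<exists>N\<in>stoch_nbhds. x <+\<^bsub>E\<^esub> N \<subseteq> U)"
proof -
  have shrink: "stoch_nbhd Q e \<subseteq> nbhd_eps_lambda M E Q \<epsilon> \<delta>"
    if Q: "finite Q" "Q \<subseteq> P" and e: "e \<le> \<epsilon>" "e \<le> \<delta>" for Q e \<epsilon> \<delta>
  proof -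
    have "prob {w \<in> space M. \<epsilon> \<le> seminorm_rep Q y w} \<le> prob {w \<in> space M. e \<le> seminorm_rep Q y w}"
      if y: "y \<in> carrier E" for y
    proof -
      have [measurable]: "seminorm_rep Q y \<in> borel_measurable M" using Q y by measurable
      show ?thesis using e by (intro finite_measure_mono) auto
    qed
    then show ?thesis using e by (force simp: nbhd_eps_lambda_iff[OF Q] stoch_nbhd_def)
  qed
  \<comment> \<open>The constant \<open>1/2\<close> keeps the probability parameter below 1, as the
    definition of \<open>T_eps_lambda\<close> demands, even when \<open>e\<close> is large.\<close>
  have half: "nbhd_eps_lambda M E Q e (min e (1/2)) \<subseteq> stoch_nbhd Q e" if Q: "finite Q" "Q \<subseteq> P" for Q e
    by (auto simp: nbhd_eps_lambda_iff[OF Q] stoch_nbhd_def)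
  have mono: "x <+\<^bsub>E\<^esub> A \<subseteq> x <+\<^bsub>E\<^esub> B" if "A \<subseteq> B" for x A B
    using that by (auto simp: a_l_coset_def')
  have "(\<exists>Q \<epsilon> \<delta>. finite Q \<and> Q \<subseteq> P \<and> 0 < \<epsilon> \<and> 0 < \<delta> \<and> \<delta> < 1 \<and> x <+\<^bsub>E\<^esub> nbhd_eps_lambda M E Q \<epsilon> \<delta> \<subseteq> U) \<longleftrightarrow>
      (\<exists>N\<in>stoch_nbhds. x <+\<^bsub>E\<^esub> N \<subseteq> U)" for x
  proof
    assume "\<exists>Q \<epsilon> \<delta>. finite Q \<and> Q \<subseteq> P \<and> 0 < \<epsilon> \<and> 0 < \<delta> \<and> \<delta> < 1 \<and> x <+\<^bsub>E\<^esub> nbhd_eps_lambda M E Q \<epsilon> \<delta> \<subseteq> U"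
    then obtain Q \<epsilon> \<delta> where *: "finite Q" "Q \<subseteq> P" "0 < \<epsilon>" "0 < \<delta>"
        "x <+\<^bsub>E\<^esub> nbhd_eps_lambda M E Q \<epsilon> \<delta> \<subseteq> U" by blast
    have "x <+\<^bsub>E\<^esub> stoch_nbhd Q (min \<epsilon> \<delta>) \<subseteq> U"
      using mono[OF shrink[OF *(1,2), of "min \<epsilon> \<delta>" \<epsilon> \<delta>]] *(5) by force
    moreover have "stoch_nbhd Q (min \<epsilon> \<delta>) \<in> stoch_nbhds"
      using * by (auto intro!: exI[of _ Q] exI[of _ "min \<epsilon> \<delta>"])
    ultimately show "\<exists>N\<in>stoch_nbhds. x <+\<^bsub>E\<^esub> N \<subseteq> U" by blast
  next
    assume "\<exists>N\<in>stoch_nbhds. x <+\<^bsub>E\<^esub> N \<subseteq> U"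
    then obtain Q e where *: "finite Q" "Q \<subseteq> P" "0 < e" "x <+\<^bsub>E\<^esub> stoch_nbhd Q e \<subseteq> U" by blast
    have "x <+\<^bsub>E\<^esub> nbhd_eps_lambda M E Q e (min e (1/2)) \<subseteq> U"
      using mono[OF half[OF *(1,2)]] *(4) by (rule order_trans)
    with * show "\<exists>Q \<epsilon> \<delta>. finite Q \<and> Q \<subseteq> P \<and> 0 < \<epsilon> \<and> 0 < \<delta> \<and> \<delta> < 1 \<and>
        x <+\<^bsub>E\<^esub> nbhd_eps_lambda M E Q \<epsilon> \<delta> \<subseteq> U"
      by (intro exI[of _ Q] exI[of _ e] exI[of _ "min e (1/2)"]) auto
  qed
  then show ?thesis by (simp only: openin_T_eps_lambda[OF rlcm])
qed

lemma as_nbhd_add: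
  assumes Q: "finite Q" "Q \<subseteq> P" and a: "a \<in> as_nbhd Q (\<lambda>w. g w / 2)" and b: "b \<in> as_nbhd Q (\<lambda>w. g w / 2)"
  shows "a \<oplus>\<^bsub>E\<^esub> b \<in> as_nbhd Q g"
proof -
  have ab: "a \<in> carrier E" "b \<in> carrier E" using a b by (auto simp: as_nbhd_def)
  have "AE w in M. seminorm_rep Q a w \<le> g w / 2" "AE w in M. seminorm_rep Q b w \<le> g w / 2"
    using a b by (auto simp: as_nbhd_def)
  with seminorm_rep_add[OF Q ab] have "AE w in M. seminorm_rep Q (a \<oplus>\<^bsub>E\<^esub> b) w \<le> g w"
    by eventually_elim simp
  with ab show ?thesis by (simp add: as_nbhd_def)
qed

text \<open>Two numbers with sum at least \<open>e\<close> cannot both lie below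
  \<open>e / 2\<close>, so the union bound applies.\<close>

lemma stoch_nbhd_add:
  assumes Q: "finite Q" "Q \<subseteq> P" and a: "a \<in> stoch_nbhd Q (e / 2)" and b: "b \<in> stoch_nbhd Q (e / 2)"
  shows "a \<oplus>\<^bsub>E\<^esub> b \<in> stoch_nbhd Q e"
proof -
  have ab: "a \<in> carrier E" "b \<in> carrier E" using a b by (auto simp: stoch_nbhd_def)
  then have abc: "a \<oplus>\<^bsub>E\<^esub> b \<in> carrier E" by simp
  have [measurable]: "seminorm_rep Q a \<in> borel_measurable M" "seminorm_rep Q b \<in> borel_measurable M"
      "seminorm_rep Q (a \<oplus>\<^bsub>E\<^esub> b) \<in> borel_measurable M"
    using Q ab abc seminorm_rep_measurable by auto
  have "AE w in M. e \<le> seminorm_rep Q (a \<oplus>\<^bsub>E\<^esub> b) w \<longrightarrow>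
      e / 2 \<le> seminorm_rep Q a w \<or> e / 2 \<le> seminorm_rep Q b w"
    using seminorm_rep_add[OF Q ab] by eventually_elim auto
  then have "prob {w \<in> space M. e \<le> seminorm_rep Q (a \<oplus>\<^bsub>E\<^esub> b) w} \<le>
      prob {w \<in> space M. e / 2 \<le> seminorm_rep Q a w} + prob {w \<in> space M. e / 2 \<le> seminorm_rep Q b w}"
    by (rule prob_union_bound_AE) measurable
  also have "\<dots> < e" using a b by (auto simp: stoch_nbhd_def)
  finally show ?thesis using abc by (simp add: stoch_nbhd_def)
qed

lemma as_nbhd_base:
  shows "\<And>N. N \<in> as_nbhds \<Longrightarrow> N \<subseteq> carrier E"
    and "\<And>N. N \<in> as_nbhds \<Longrightarrow> \<zero>\<^bsub>E\<^esub> \<in> N"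
    and "\<And>N. N \<in> as_nbhds \<Longrightarrow> \<exists>N'\<in>as_nbhds. \<forall>a\<in>N'. \<forall>b\<in>N'. a \<oplus>\<^bsub>E\<^esub> b \<in> N"
    and "as_nbhds \<noteq> {}"
proof -
  fix N assume "N \<in> as_nbhds"
  then obtain Q g where N: "N = as_nbhd Q g" and Qg: "(Q, g) \<in> gauges" by auto
  then have Q: "finite Q" "Q \<subseteq> P" and g: "g \<in> borel_measurable M" and pos: "AE w in M. 0 < g w"
    by (auto simp: gauges_def)
  show "N \<subseteq> carrier E" by (auto simp: N as_nbhd_def)
  have "AE w in M. seminorm_rep Q \<zero>\<^bsub>E\<^esub> w \<le> g w"
    using seminorm_rep_zero[OF Q] pos by eventually_elim simp
  then show "\<zero>\<^bsub>E\<^esub> \<in> N" by (simp add: N as_nbhd_def)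
  have "(Q, \<lambda>w. g w / 2) \<in> gauges" using Q g pos by (simp add: gauges_def)
  then show "\<exists>N'\<in>as_nbhds. \<forall>a\<in>N'. \<forall>b\<in>N'. a \<oplus>\<^bsub>E\<^esub> b \<in> N"
    unfolding N using as_nbhd_add[OF Q] by force
next
  have "({}, \<lambda>_. 1) \<in> gauges" by (simp add: gauges_def)
  then show "as_nbhds \<noteq> {}" by auto
qed

lemma stoch_nbhd_base:
  shows "\<And>N. N \<in> stoch_nbhds \<Longrightarrow> N \<subseteq> carrier E"
    and "\<And>N. N \<in> stoch_nbhds \<Longrightarrow> \<zero>\<^bsub>E\<^esub> \<in> N"
    and "\<And>N. N \<in> stoch_nbhds \<Longrightarrow> \<exists>N'\<in>stoch_nbhds. \<forall>a\<in>N'. \<forall>b\<in>N'. a \<oplus>\<^bsub>E\<^esub> b \<in> N"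
    and "stoch_nbhds \<noteq> {}"
proof -
  fix N assume "N \<in> stoch_nbhds"
  then obtain Q e where N: "N = stoch_nbhd Q e" and Q: "finite Q" "Q \<subseteq> P" and e: "0 < e"
    by auto
  show "N \<subseteq> carrier E" by (auto simp: N stoch_nbhd_def)
  have "AE w in M. \<not> e \<le> seminorm_rep Q \<zero>\<^bsub>E\<^esub> w"
    using seminorm_rep_zero[OF Q] by eventually_elim (use e in simp)
  then have "prob {w \<in> space M. e \<le> seminorm_rep Q \<zero>\<^bsub>E\<^esub> w} = 0"
    by (rule prob_eq_0_AE)
  then show "\<zero>\<^bsub>E\<^esub> \<in> N" using e by (simp add: N stoch_nbhd_def)
  have "stoch_nbhd Q (e / 2) \<in> stoch_nbhds" using Q e half_gt_zero by blast
  then show "\<exists>N'\<in>stoch_nbhds. \<forall>a\<in>N'. \<forall>b\<in>N'. a \<oplus>\<^bsub>E\<^esub> b \<in> N"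
    unfolding N using stoch_nbhd_add[OF Q] by blast
next
  have "stoch_nbhd {} 1 \<in> stoch_nbhds" using zero_less_one by blast
  then show "stoch_nbhds \<noteq> {}" by blast
qed

section \<open>Convergence and Cauchy nets in terms of the two bases\<close>

interpretation T_c: translation_invariant_topology E "T_c M E P" as_nbhds
  by unfold_locales (rule openin_T_c_iff_as_nbhd as_nbhd_base; assumption?)+

interpretation T_eps_lambda: translation_invariant_topology E "T_eps_lambda M E P" stoch_nbhds
  by unfold_locales (rule openin_T_eps_lambda_iff_stoch_nbhd stoch_nbhd_base; assumption?)+

lemma net_converges_T_c_iff:
  assumes "x ` I \<subseteq> carrier E"
  shows "net_converges (T_c M E P) I r x l \<longleftrightarrow> l \<in> carrier E \<and>
    (\<forall>(Q, g)\<in>gauges. \<exists>i\<in>I. \<forall>j\<in>I. (i, j) \<in> r \<longrightarrow> x j \<ominus>\<^bsub>E\<^esub> l \<in> as_nbhd Q g)"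
  by (simp add: T_c.net_converges_iff_base[OF assms] split_def)

lemma Cauchy_net_T_c_iff:
  "Cauchy_net E (T_c M E P) I r x \<longleftrightarrow> x ` I \<subseteq> carrier E \<and>
    (\<forall>(Q, g)\<in>gauges. \<exists>i\<in>I. \<forall>j\<in>I. \<forall>k\<in>I. (i, j) \<in> r \<and> (i, k) \<in> r \<longrightarrow> x j \<ominus>\<^bsub>E\<^esub> x k \<in> as_nbhd Q g)"
  by (simp add: T_c.Cauchy_net_iff_base split_def)

lemma net_converges_T_eps_lambda_iff:
  assumes "x ` I \<subseteq> carrier E"
  shows "net_converges (T_eps_lambda M E P) I r x l \<longleftrightarrow> l \<in> carrier E \<and>
    (\<forall>Q e. finite Q \<and> Q \<subseteq> P \<and> 0 < e \<longrightarrow>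
      (\<exists>i\<in>I. \<forall>j\<in>I. (i, j) \<in> r \<longrightarrow> x j \<ominus>\<^bsub>E\<^esub> l \<in> stoch_nbhd Q e))"
  unfolding T_eps_lambda.net_converges_iff_base[OF assms]
  by blast

lemma Cauchy_net_T_eps_lambda_iff:
  "Cauchy_net E (T_eps_lambda M E P) I r x \<longleftrightarrow> x ` I \<subseteq> carrier E \<and>
    (\<forall>Q e. finite Q \<and> Q \<subseteq> P \<and> 0 < e \<longrightarrow>
      (\<exists>i\<in>I. \<forall>j\<in>I. \<forall>k\<in>I. (i, j) \<in> r \<and> (i, k) \<in> r \<longrightarrow> x j \<ominus>\<^bsub>E\<^esub> x k \<in> stoch_nbhd Q e))"
  unfolding T_eps_lambda.Cauchy_net_iff_base
  by blast

section \<open>Completeness\<close>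

lemma directed_bound:
  assumes "directed I r" "i \<in> I" "j \<in> I"
  obtains k where "k \<in> I" "(i, k) \<in> r" "(j, k) \<in> r"
  using assms unfolding directed_def by blast

lemma directed_trans:
  assumes "directed I r" "(i, j) \<in> r" "(j, k) \<in> r"
  shows "(i, k) \<in> r"
  using assms unfolding directed_def preorder_on_def by (blast dest: transD)

section \<open>Completeness passes from \<open>T_eps_lambda\<close> to \<open>T_c\<close>\<close>

lemma T_c_complete_if_T_eps_lambda_complete:
  assumes complete: "net_complete E (T_eps_lambda M E P)"
  shows "net_complete E (T_c M E P)"
  unfolding net_complete_def
proof (intro allI impI, elim conjE)
  fix I :: "('e set \<times> 'e) set" and r x
  assume dir: "directed I r" and C: "Cauchy_net E (T_c M E P) I r x"
  have Cx: "\<exists>i\<in>I. \<forall>j\<in>I. \<forall>k\<in>I. (i, j) \<in> r \<and> (i, k) \<in> r \<longrightarrow> x j \<ominus>\<^bsub>E\<^esub> x k \<in> as_nbhd Q g"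
    if "(Q, g) \<in> gauges" for Q g
    using C that by (auto simp: Cauchy_net_T_c_iff)
  have xI: "x ` I \<subseteq> carrier E" using C by (simp add: Cauchy_net_T_c_iff)
  \<comment> \<open>The exceptional event includes equality with \<open>e\<close>; the radius
    \<open>e / 2\<close> makes it null.\<close>
  have as_stoch: "as_nbhd Q (\<lambda>_. e / 2) \<subseteq> stoch_nbhd Q e" if "0 < e" for Q e
  proof
    fix y assume y: "y \<in> as_nbhd Q (\<lambda>_. e / 2)"
    then have "AE w in M. seminorm_rep Q y w \<le> e / 2" by (simp add: as_nbhd_def)
    then have "AE w in M. \<not> e \<le> seminorm_rep Q y w"
      by eventually_elim (use that in simp)
    then have "prob {w \<in> space M. e \<le> seminorm_rep Q y w} = 0" by (rule prob_eq_0_AE)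
    with y that show "y \<in> stoch_nbhd Q e" by (simp add: stoch_nbhd_def as_nbhd_def)
  qed
  have "Cauchy_net E (T_eps_lambda M E P) I r x"
    unfolding Cauchy_net_T_eps_lambda_iff
  proof (intro conjI allI impI xI)
    fix Q and e :: real assume *: "finite Q \<and> Q \<subseteq> P \<and> 0 < e"
    then have "(Q, \<lambda>_. e / 2) \<in> gauges" by (simp add: gauges_def)
    from Cx[OF this] show "\<exists>i\<in>I. \<forall>j\<in>I. \<forall>k\<in>I. (i, j) \<in> r \<and> (i, k) \<in> r \<longrightarrow>
        x j \<ominus>\<^bsub>E\<^esub> x k \<in> stoch_nbhd Q e"
      using as_stoch[of e Q] * by blast
  qed
  then obtain l where conv: "net_converges (T_eps_lambda M E P) I r x l"
    using complete dir unfolding net_complete_def by blast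
  then have l: "l \<in> carrier E" by (simp add: net_converges_T_eps_lambda_iff[OF xI])
  have conv_stoch: "\<exists>i\<in>I. \<forall>j\<in>I. (i, j) \<in> r \<longrightarrow> x j \<ominus>\<^bsub>E\<^esub> l \<in> stoch_nbhd Q e"
    if "finite Q" "Q \<subseteq> P" "0 < e" for Q e
    using conv that by (simp add: net_converges_T_eps_lambda_iff[OF xI])
  have "net_converges (T_c M E P) I r x l"
    unfolding net_converges_T_c_iff[OF xI]
  proof (intro conjI l ballI, clarify)
    fix Q g assume Qg: "(Q, g) \<in> gauges"
    then have Q: "finite Q" "Q \<subseteq> P" and [measurable]: "g \<in> borel_measurable M"
      by (auto simp: gauges_def)
    obtain i where i: "i \<in> I"
      "\<And>j k. j \<in> I \<Longrightarrow> k \<in> I \<Longrightarrow> (i, j) \<in> r \<Longrightarrow> (i, k) \<in> r \<Longrightarrow> x j \<ominus>\<^bsub>E\<^esub> x k \<in> as_nbhd Q g"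
      using Cx[OF Qg] by blast
    \<comment> \<open>The index \<open>i\<close> of the Cauchy condition already serves for
      convergence. The intermediate index \<open>k\<close> may depend on \<open>e\<close>:
      \<open>x j\<close> is within \<open>g\<close> of \<open>x k\<close> almost surely, and
      \<open>x k\<close> is within \<open>e\<close> of \<open>l\<close> outside an event of
      probability less than \<open>e\<close>.\<close>
    have "x j \<ominus>\<^bsub>E\<^esub> l \<in> as_nbhd Q g" if j: "j \<in> I" "(i, j) \<in> r" for j
    proof -
      have xj: "x j \<in> carrier E" using j xI by blast
      then have xjl: "x j \<ominus>\<^bsub>E\<^esub> l \<in> carrier E" using l by simp
      have [measurable]: "seminorm_rep Q (x j \<ominus>\<^bsub>E\<^esub> l) \<in> borel_measurable M"
        by (rule seminorm_rep_measurable[OF Q xjl])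
      have "AE w in M. seminorm_rep Q (x j \<ominus>\<^bsub>E\<^esub> l) w \<le> g w"
      proof (rule AE_le_if_prob_small)
        fix e :: real assume e: "0 < e"
        obtain i' where i': "i' \<in> I" "\<And>k. k \<in> I \<Longrightarrow> (i', k) \<in> r \<Longrightarrow> x k \<ominus>\<^bsub>E\<^esub> l \<in> stoch_nbhd Q e"
          using conv_stoch[OF Q e] by blast
        obtain k where k: "k \<in> I" "(i, k) \<in> r" "(i', k) \<in> r"
          using directed_bound[OF dir i(1) i'(1)] by blast
        have xk: "x k \<in> carrier E" using k xI by blast
        then have xkl: "x k \<ominus>\<^bsub>E\<^esub> l \<in> carrier E" using l by simp
        have [measurable]: "seminorm_rep Q (x k \<ominus>\<^bsub>E\<^esub> l) \<in> borel_measurable M"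
          by (rule seminorm_rep_measurable[OF Q xkl])
        have "AE w in M. seminorm_rep Q (x j \<ominus>\<^bsub>E\<^esub> x k) w \<le> g w"
          using i(2)[OF j(1) k(1) j(2) k(2)] by (simp add: as_nbhd_def)
        with seminorm_rep_triangle[OF Q xj xk l]
        have "AE w in M. w \<in> {w \<in> space M. g w + e \<le> seminorm_rep Q (x j \<ominus>\<^bsub>E\<^esub> l) w} \<longrightarrow>
            w \<in> {w \<in> space M. e \<le> seminorm_rep Q (x k \<ominus>\<^bsub>E\<^esub> l) w}"
          by eventually_elim auto
        then have "prob {w \<in> space M. g w + e \<le> seminorm_rep Q (x j \<ominus>\<^bsub>E\<^esub> l) w} \<le>
            prob {w \<in> space M. e \<le> seminorm_rep Q (x k \<ominus>\<^bsub>E\<^esub> l) w}"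
          by (rule finite_measure_mono_AE) measurable
        also have "\<dots> < e" using i'(2)[OF k(1,3)] by (simp add: stoch_nbhd_def)
        finally show "prob {w \<in> space M. g w + e \<le> seminorm_rep Q (x j \<ominus>\<^bsub>E\<^esub> l) w} \<le> e" by simp
      qed measurable
      with xjl show ?thesis by (simp add: as_nbhd_def)
    qed
    with i(1) show "\<exists>i\<in>I. \<forall>j\<in>I. (i, j) \<in> r \<longrightarrow> x j \<ominus>\<^bsub>E\<^esub> l \<in> as_nbhd Q g" by blast
  qed
  then show "\<exists>l. net_converges (T_c M E P) I r x l" ..
qed

section \<open>Completeness passes from \<open>T_c\<close> to \<open>T_eps_lambda\<close>\<close>

context
  fixes I :: "'i set" and r :: "'i rel" and x :: "'i \<Rightarrow> 'e"
  assumes dir: "directed I r" and xI: "x ` I \<subseteq> carrier E"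
begin

text \<open>
  The points within \<open>g\<close>, almost surely and with respect to \<open>Q\<close>, of the limit in probability
  that the net would have in a completion.
\<close>

definition near_limit :: "('e \<Rightarrow> ('w \<Rightarrow> real) set) set \<Rightarrow> ('w \<Rightarrow> real) \<Rightarrow> 'e set" where
  "near_limit Q g = {y \<in> carrier E. \<forall>e>0. \<exists>i\<in>I. \<forall>j\<in>I. (i, j) \<in> r \<longrightarrow>
     measure M {w \<in> space M. g w + e \<le> seminorm_rep Q (y \<ominus>\<^bsub>E\<^esub> x j) w} < e}"

text \<open>Ensures that all terms of the auxiliary net beyond a gauge remain near the limit with
  respect to that gauge: a larger family and a smaller radius only enlarge the deviation
  events.\<close>

lemma near_limit_mono:
  assumes Q': "(Q', g') \<in> gauges" and Q: "(Q, g) \<in> gauges"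
    and sub: "Q \<subseteq> Q'" and le: "AE w in M. g' w \<le> g w"
  shows "near_limit Q' g' \<subseteq> near_limit Q g"
proof
  fix y assume y: "y \<in> near_limit Q' g'"
  then have yc: "y \<in> carrier E" by (simp add: near_limit_def)
  have fin: "finite Q'" "Q' \<subseteq> P" "finite Q" "Q \<subseteq> P"
    and [measurable]: "g \<in> borel_measurable M" "g' \<in> borel_measurable M"
    using Q Q' by (auto simp: gauges_def)
  have "prob {w \<in> space M. g w + e \<le> seminorm_rep Q (y \<ominus>\<^bsub>E\<^esub> x j) w}
      \<le> prob {w \<in> space M. g' w + e \<le> seminorm_rep Q' (y \<ominus>\<^bsub>E\<^esub> x j) w}" if "j \<in> I" for j e
  proof (rule finite_measure_mono_AE)
    have d: "y \<ominus>\<^bsub>E\<^esub> x j \<in> carrier E" using yc that xI by (intro E.minus_closed) auto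
    have [measurable]: "seminorm_rep Q' (y \<ominus>\<^bsub>E\<^esub> x j) \<in> borel_measurable M"
      by (rule seminorm_rep_measurable[OF fin(1,2) d])
    show "AE w in M. w \<in> {w \<in> space M. g w + e \<le> seminorm_rep Q (y \<ominus>\<^bsub>E\<^esub> x j) w} \<longrightarrow>
        w \<in> {w \<in> space M. g' w + e \<le> seminorm_rep Q' (y \<ominus>\<^bsub>E\<^esub> x j) w}"
      using seminorm_rep_mono[OF fin(1,2) sub d] le by eventually_elim auto
    show "{w \<in> space M. g' w + e \<le> seminorm_rep Q' (y \<ominus>\<^bsub>E\<^esub> x j) w} \<in> sets M" by measurable
  qed
  then show "y \<in> near_limit Q g"
    using y unfolding near_limit_def by (blast intro: le_less_trans)
qed

text \<open>Both points are compared with a common late term \<open>x k\<close>. Each comparison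
  costs \<open>g\<close> plus \<open>e/2\<close>, outside an event of probability below
  \<open>e/2\<close>, and \<open>e\<close> is arbitrary.\<close>

lemma near_limit_close:
  assumes Q: "(Q, g) \<in> gauges" and y: "y \<in> near_limit Q g" and z: "z \<in> near_limit Q g"
  shows "AE w in M. seminorm_rep Q (y \<ominus>\<^bsub>E\<^esub> z) w \<le> 2 * g w"
proof -
  have fin: "finite Q" "Q \<subseteq> P" and [measurable]: "g \<in> borel_measurable M"
    using Q by (auto simp: gauges_def)
  have yc: "y \<in> carrier E" and zc: "z \<in> carrier E" using y z by (auto simp: near_limit_def)
  have [measurable]: "seminorm_rep Q (y \<ominus>\<^bsub>E\<^esub> z) \<in> borel_measurable M"
    using yc zc by (intro seminorm_rep_measurable[OF fin] E.minus_closed)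
  show ?thesis
  proof (rule AE_le_if_prob_small)
    fix e :: real assume e: "0 < e"
    obtain i where i: "i \<in> I" "\<And>j. j \<in> I \<Longrightarrow> (i, j) \<in> r \<Longrightarrow>
        prob {w \<in> space M. g w + e/2 \<le> seminorm_rep Q (y \<ominus>\<^bsub>E\<^esub> x j) w} < e/2"
      using y half_gt_zero[OF e] unfolding near_limit_def by blast
    obtain i' where i': "i' \<in> I" "\<And>j. j \<in> I \<Longrightarrow> (i', j) \<in> r \<Longrightarrow>
        prob {w \<in> space M. g w + e/2 \<le> seminorm_rep Q (z \<ominus>\<^bsub>E\<^esub> x j) w} < e/2"
      using z half_gt_zero[OF e] unfolding near_limit_def by blast
    obtain k where k: "k \<in> I" "(i, k) \<in> r" "(i', k) \<in> r"
      using directed_bound[OF dir i(1) i'(1)] by blast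
    have xk: "x k \<in> carrier E" using k xI by blast
    have [measurable]: "seminorm_rep Q (y \<ominus>\<^bsub>E\<^esub> x k) \<in> borel_measurable M"
        "seminorm_rep Q (z \<ominus>\<^bsub>E\<^esub> x k) \<in> borel_measurable M"
      using yc zc xk by (auto intro!: seminorm_rep_measurable[OF fin] E.minus_closed)
    have "AE w in M. 2 * g w + e \<le> seminorm_rep Q (y \<ominus>\<^bsub>E\<^esub> z) w \<longrightarrow>
        g w + e/2 \<le> seminorm_rep Q (y \<ominus>\<^bsub>E\<^esub> x k) w \<or> g w + e/2 \<le> seminorm_rep Q (z \<ominus>\<^bsub>E\<^esub> x k) w"
      using seminorm_rep_triangle[OF fin yc xk zc] seminorm_rep_minus_commute[OF fin xk zc]
      by eventually_elim auto
    then have "prob {w \<in> space M. 2 * g w + e \<le> seminorm_rep Q (y \<ominus>\<^bsub>E\<^esub> z) w}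
      \<le> prob {w \<in> space M. g w + e/2 \<le> seminorm_rep Q (y \<ominus>\<^bsub>E\<^esub> x k) w}
        + prob {w \<in> space M. g w + e/2 \<le> seminorm_rep Q (z \<ominus>\<^bsub>E\<^esub> x k) w}"
      by (rule prob_union_bound_AE) measurable
    also have "\<dots> \<le> e" using i(2)[OF k(1,2)] i'(2)[OF k(1,3)] by simp
    finally show "prob {w \<in> space M. 2 * g w + e \<le> seminorm_rep Q (y \<ominus>\<^bsub>E\<^esub> z) w} \<le> e" .
  qed measurable
qed

lemma near_limit_nonempty:
  assumes concat: "countable_concatenation_property M E"
    and C: "Cauchy_net E (T_eps_lambda M E P) I r x" and Qg: "(Q, g) \<in> gauges"
  shows "near_limit Q g \<noteq> {}"
proof -
  have fin: "finite Q" "Q \<subseteq> P" and [measurable]: "g \<in> borel_measurable M"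
    and pos: "AE w in M. 0 < g w"
    using Qg by (auto simp: gauges_def)
  let ?c = "\<lambda>n::nat. (1/2::real) ^ n"
  \<comment> \<open>Consecutive terms of \<open>x \<circ> a\<close> are \<open>2\<^sup>-\<^sup>n\<close>-close with probability at least \<open>1 - 2\<^sup>-\<^sup>n\<close>, hence
    \<open>x \<circ> a\<close> is almost surely Cauchy (Borel--Cantelli); gluing the \<open>x (a n)\<close> along the sets where
    \<open>n\<close> is the first index after which the terms are \<open>g\<close>-close gives the required point.\<close>
  have "\<exists>i\<in>I. \<forall>j\<in>I. \<forall>k\<in>I. (i, j) \<in> r \<and> (i, k) \<in> r \<longrightarrow> x j \<ominus>\<^bsub>E\<^esub> x k \<in> stoch_nbhd Q (?c n)" for n
    using C fin by (simp add: Cauchy_net_T_eps_lambda_iff)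
  then obtain i0 where i0: "\<And>n. i0 n \<in> I" "\<And>n j k. j \<in> I \<Longrightarrow> k \<in> I \<Longrightarrow> (i0 n, j) \<in> r \<Longrightarrow>
      (i0 n, k) \<in> r \<Longrightarrow> x j \<ominus>\<^bsub>E\<^esub> x k \<in> stoch_nbhd Q (?c n)"
    by metis
  \<comment> \<open>Directedness supplies a common bound of \<open>a n\<close> and
    \<open>i0 (Suc n)\<close>. The chain condition puts every index above \<open>a n\<close> beyond
    \<open>i0 n\<close>, where the estimate with \<open>?c n\<close> holds.\<close>
  have "\<exists>a. \<forall>n. (a n \<in> I \<and> (i0 n, a n) \<in> r) \<and> (a n, a (Suc n)) \<in> r"
  proof (rule dependent_nat_choice)
    show "\<exists>i. i \<in> I \<and> (i0 0, i) \<in> r" using directed_bound[OF dir i0(1) i0(1)] by blast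
    fix i n assume "i \<in> I \<and> (i0 n, i) \<in> r"
    then show "\<exists>j. (j \<in> I \<and> (i0 (Suc n), j) \<in> r) \<and> (i, j) \<in> r"
      using directed_bound[OF dir _ i0(1)] by blast
  qed
  then obtain a where a: "\<And>n. a n \<in> I" "\<And>n. (i0 n, a n) \<in> r" "\<And>n. (a n, a (Suc n)) \<in> r" by blast
  have a_le: "(i0 n, j) \<in> r" if "(a n, j) \<in> r" for n j
    using directed_trans[OF dir a(2) that] .
  have xa: "x (a n) \<in> carrier E" for n using a(1) xI by blast
  have d_meas [measurable]: "seminorm_rep Q (x (a n) \<ominus>\<^bsub>E\<^esub> x (a m)) \<in> borel_measurable M" for n m
    by (intro seminorm_rep_measurable[OF fin] E.minus_closed xa)
  have step: "prob {w \<in> space M. ?c n \<le> seminorm_rep Q (x (a n) \<ominus>\<^bsub>E\<^esub> x (a (Suc n))) w} < ?c n" for n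
    using i0(2)[OF a(1) a(1) a(2) a_le[OF a(3)]] by (simp add: stoch_nbhd_def)
  have "AE w in M. eventually (\<lambda>n. w \<in> space M -
      {w \<in> space M. ?c n \<le> seminorm_rep Q (x (a n) \<ominus>\<^bsub>E\<^esub> x (a (Suc n))) w}) sequentially"
  proof (rule borel_cantelli_AE1)
    show "summable (\<lambda>n. prob {w \<in> space M. ?c n \<le> seminorm_rep Q (x (a n) \<ominus>\<^bsub>E\<^esub> x (a (Suc n))) w})"
      by (rule summable_comparison_test'[of ?c 0])
        (auto intro: less_imp_le[OF step] summable_geometric)
  qed (auto simp: less_top[symmetric])
  \<comment> \<open>Telescoping by the triangle inequality; since \<open>n\<close> and
    \<open>k\<close> are countable, one null set serves for all of them.\<close>
  moreover have "AE w in M. \<forall>n k. seminorm_rep Q (x (a n) \<ominus>\<^bsub>E\<^esub> x (a (n + k))) w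
      \<le> (\<Sum>i<k. seminorm_rep Q (x (a (n + i)) \<ominus>\<^bsub>E\<^esub> x (a (Suc (n + i)))) w)"
    unfolding AE_all_countable
  proof (intro allI)
    fix n k
    show "AE w in M. seminorm_rep Q (x (a n) \<ominus>\<^bsub>E\<^esub> x (a (n + k))) w
        \<le> (\<Sum>i<k. seminorm_rep Q (x (a (n + i)) \<ominus>\<^bsub>E\<^esub> x (a (Suc (n + i)))) w)"
    proof (induction k)
      case 0
      have "x (a n) \<ominus>\<^bsub>E\<^esub> x (a n) = \<zero>\<^bsub>E\<^esub>" using xa by (simp add: a_minus_def E.r_neg)
      with seminorm_rep_zero[OF fin] show ?case by auto
    next
      case (Suc k)
      with seminorm_rep_triangle[OF fin xa xa xa, of n "n + Suc k" "n + k"]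
      show ?case by eventually_elim simp
    qed
  qed
  ultimately have ex: "AE w in M. \<exists>n. \<forall>m\<ge>n. seminorm_rep Q (x (a n) \<ominus>\<^bsub>E\<^esub> x (a m)) w \<le> g w"
    using pos
  proof eventually_elim
    case (elim w)
    let ?d = "\<lambda>n. seminorm_rep Q (x (a n) \<ominus>\<^bsub>E\<^esub> x (a (Suc n))) w"
    obtain n0 where n0: "\<And>n. n \<ge> n0 \<Longrightarrow> ?d n < ?c n"
      using elim(1) by (auto simp: eventually_sequentially not_le)
    \<comment> \<open>The geometric series started at \<open>n\<close> sums to at most
      \<open>2 * ?c n\<close>. This falls below \<open>g w\<close> for large \<open>n\<close>
      because \<open>g w\<close> is positive.\<close>
    have "(\<lambda>n. 2 * ?c n) \<longlonglongrightarrow> 2 * 0"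
      by (intro tendsto_intros LIMSEQ_realpow_zero) auto
    then have "eventually (\<lambda>n. 2 * ?c n < g w) sequentially"
      using elim(3) by (intro order_tendstoD(2)) auto
    then obtain n1 where n1: "\<And>n. n \<ge> n1 \<Longrightarrow> 2 * ?c n < g w"
      by (auto simp: eventually_sequentially)
    let ?n = "max n0 n1"
    have "seminorm_rep Q (x (a ?n) \<ominus>\<^bsub>E\<^esub> x (a m)) w \<le> g w" if "m \<ge> ?n" for m
    proof -
      have "seminorm_rep Q (x (a ?n) \<ominus>\<^bsub>E\<^esub> x (a (?n + (m - ?n)))) w \<le> (\<Sum>i<m - ?n. ?d (?n + i))"
        using elim(2) by blast
      also have "\<dots> \<le> (\<Sum>i<m - ?n. ?c (?n + i))"
        by (intro sum_mono n0[THEN less_imp_le]) simp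
      also have "\<dots> = ?c ?n * (\<Sum>i<m - ?n. ?c i)" by (simp add: sum_distrib_left power_add)
      also have "(\<Sum>i<m - ?n. ?c i) \<le> 2" by (simp add: sum_gp_strict)
      finally have "seminorm_rep Q (x (a ?n) \<ominus>\<^bsub>E\<^esub> x (a (?n + (m - ?n)))) w \<le> 2 * ?c ?n" by simp
      with n1[of ?n] that show ?thesis by simp
    qed
    then show ?case by blast
  qed
  \<comment> \<open>Where no such \<open>n\<close> exists, which is a null set, the value is an
    unspecified natural number. Thus \<open>N\<close> is total, and its level sets
    \<open>A n\<close> partition the whole space, as concatenation requires.\<close>
  define N where "N w = (LEAST n. \<forall>m\<ge>n. seminorm_rep Q (x (a n) \<ominus>\<^bsub>E\<^esub> x (a m)) w \<le> g w)" for w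
  have [measurable]: "N \<in> measurable M (count_space UNIV)" unfolding N_def by measurable
  define A where "A n = {w \<in> space M. N w = n}" for n
  have A [measurable]: "A n \<in> sets M" for n unfolding A_def by measurable
  have "\<exists>y\<in>carrier E. \<forall>n. L0_ind M (A n) \<odot>\<^bsub>E\<^esub> y = L0_ind M (A n) \<odot>\<^bsub>E\<^esub> x (a n)"
  proof (rule concat[unfolded countable_concatenation_property_def, rule_format], intro conjI)
    show "range (\<lambda>n. x (a n)) \<subseteq> carrier E" "range A \<subseteq> sets M" using xa A by blast+
    show "disjoint_family A" "(\<Union>n. A n) = space M" by (auto simp: disjoint_family_on_def A_def)
  qed
  then obtain y where y: "y \<in> carrier E" "\<And>n. L0_ind M (A n) \<odot>\<^bsub>E\<^esub> y = L0_ind M (A n) \<odot>\<^bsub>E\<^esub> x (a n)"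
    by blast
  have "AE w in M. \<forall>n m. w \<in> A n \<longrightarrow> seminorm_rep Q (y \<ominus>\<^bsub>E\<^esub> x (a m)) w
      \<le> seminorm_rep Q (x (a n) \<ominus>\<^bsub>E\<^esub> x (a m)) w"
    unfolding AE_all_countable using seminorm_rep_local[OF fin y(1) xa xa A y(2)] by blast
  with ex AE_space have near: "AE w in M. \<forall>m\<ge>N w. seminorm_rep Q (y \<ominus>\<^bsub>E\<^esub> x (a m)) w \<le> g w"
  proof eventually_elim
    case (elim w)
    have "\<forall>m\<ge>N w. seminorm_rep Q (x (a (N w)) \<ominus>\<^bsub>E\<^esub> x (a m)) w \<le> g w"
      unfolding N_def using elim(1) by (rule LeastI_ex)
    with elim(2,3) show ?case unfolding A_def by (blast intro: order_trans)
  qed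
  \<comment> \<open>Continuity from above: \<open>N\<close> has finite values, so these decreasing
    events have empty intersection.\<close>
  have tail: "(\<lambda>m. prob {w \<in> space M. m < N w}) \<longlonglongrightarrow> 0"
  proof -
    have "(\<lambda>m. prob {w \<in> space M. m < N w}) \<longlonglongrightarrow> prob (\<Inter>m. {w \<in> space M. m < N w})"
      by (rule finite_Lim_measure_decseq) (auto simp: decseq_def)
    moreover have "(\<Inter>m. {w \<in> space M. m < N w}) = {}" by auto
    ultimately show ?thesis by simp
  qed
  have "\<exists>i\<in>I. \<forall>j\<in>I. (i, j) \<in> r \<longrightarrow>
      prob {w \<in> space M. g w + e \<le> seminorm_rep Q (y \<ominus>\<^bsub>E\<^esub> x j) w} < e" if e: "0 < e" for e
  proof -
    \<comment> \<open>The index sought is \<open>a m\<close> for a suitable \<open>m\<close>. The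
      glued point is within \<open>g\<close> of \<open>x (a m)\<close> unless
      \<open>m < N w\<close>, and \<open>x (a m)\<close> is within \<open>?c m\<close> of
      \<open>x j\<close> outside an event of probability below \<open>?c m\<close>. Each of the two
      events has probability below \<open>e/2\<close>.\<close>
    have "?c \<longlonglongrightarrow> 0" by (intro LIMSEQ_realpow_zero) auto
    then have "eventually (\<lambda>m. ?c m < e/2 \<and> prob {w \<in> space M. m < N w} < e/2) sequentially"
      using e by (intro eventually_conj order_tendstoD(2)[OF _ half_gt_zero[OF e]] tail)
    then obtain m where m: "?c m < e/2" "prob {w \<in> space M. m < N w} < e/2"
      by (auto simp: eventually_sequentially)
    have "prob {w \<in> space M. g w + e \<le> seminorm_rep Q (y \<ominus>\<^bsub>E\<^esub> x j) w} < e"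
      if j: "j \<in> I" "(a m, j) \<in> r" for j
    proof -
      have xj: "x j \<in> carrier E" using j xI by blast
      have [measurable]: "seminorm_rep Q (y \<ominus>\<^bsub>E\<^esub> x j) \<in> borel_measurable M"
        "seminorm_rep Q (x (a m) \<ominus>\<^bsub>E\<^esub> x j) \<in> borel_measurable M"
        using y(1) xj xa by (auto intro!: seminorm_rep_measurable[OF fin] E.minus_closed)
      have "AE w in M. g w + e \<le> seminorm_rep Q (y \<ominus>\<^bsub>E\<^esub> x j) w \<longrightarrow>
          m < N w \<or> ?c m \<le> seminorm_rep Q (x (a m) \<ominus>\<^bsub>E\<^esub> x j) w"
        using near seminorm_rep_triangle[OF fin y(1) xa[of m] xj]
      proof eventually_elim
        case (elim w)
        show ?case
        proof (cases "m < N w")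
          case False
          then have "seminorm_rep Q (y \<ominus>\<^bsub>E\<^esub> x (a m)) w \<le> g w" using elim(1) by simp
          with elim(2) m(1) e show ?thesis by linarith
        qed simp
      qed
      then have "prob {w \<in> space M. g w + e \<le> seminorm_rep Q (y \<ominus>\<^bsub>E\<^esub> x j) w}
        \<le> prob {w \<in> space M. m < N w} + prob {w \<in> space M. ?c m \<le> seminorm_rep Q (x (a m) \<ominus>\<^bsub>E\<^esub> x j) w}"
        by (rule prob_union_bound_AE) measurable
      also have "prob {w \<in> space M. ?c m \<le> seminorm_rep Q (x (a m) \<ominus>\<^bsub>E\<^esub> x j) w} < ?c m"
        using i0(2)[OF a(1) j(1) a(2) a_le[OF j(2)]] by (simp add: stoch_nbhd_def)
      finally show ?thesis using m by simp
    qed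
    with a(1) show ?thesis by blast
  qed
  with y(1) have "y \<in> near_limit Q g" by (simp add: near_limit_def)
  then show ?thesis by blast
qed

lemma net_converges_T_eps_lambda:
  assumes complete: "net_complete E (T_c M E P)" and concat: "countable_concatenation_property M E"
    and C: "Cauchy_net E (T_eps_lambda M E P) I r x"
  shows "\<exists>l. net_converges (T_eps_lambda M E P) I r x l"
proof -
  \<comment> \<open>Later gauges are finer. Radii are compared almost surely, so this is a preorder,
    which is all that \<open>directed\<close> asks for.\<close>
  define s where "s = {((Q, g), (Q', g')). (Q, g) \<in> gauges \<and> (Q', g') \<in> gauges \<and>
      Q \<subseteq> Q' \<and> (AE w in M. g' w \<le> g w)}"
  define y where "y = (\<lambda>(Q, g). SOME z. z \<in> near_limit Q g)"
  have y: "y (Q, g) \<in> near_limit Q g" if "(Q, g) \<in> gauges" for Q g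
    using near_limit_nonempty[OF concat C that] by (simp add: y_def some_in_eq)
  have y_near: "y b \<in> near_limit Q g" if "((Q, g), b) \<in> s" for Q g b
  proof -
    obtain Q' g' where b: "b = (Q', g')" by (cases b)
    then have *: "(Q', g') \<in> gauges" "(Q, g) \<in> gauges" "Q \<subseteq> Q'" "AE w in M. g' w \<le> g w"
      using that by (auto simp: s_def)
    from near_limit_mono[OF this] y[OF *(1)] show ?thesis unfolding b by blast
  qed
  have yc: "y ` gauges \<subseteq> carrier E"
    using y by (force simp: near_limit_def)
  have s_refl: "(b, b) \<in> s" if "b \<in> gauges" for b using that by (cases b) (simp add: s_def)
  have "directed gauges s"
    unfolding directed_def
  proof (intro conjI ballI)
    show "gauges \<noteq> {}" using as_nbhd_base(4) by blast
    have "trans s"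
    proof (rule transI, clarify)
      fix Q1 g1 Q2 g2 Q3 g3 assume *: "((Q1, g1), (Q2, g2)) \<in> s" "((Q2, g2), (Q3, g3)) \<in> s"
      then have "AE w in M. g2 w \<le> g1 w" "AE w in M. g3 w \<le> g2 w" by (auto simp: s_def)
      then have "AE w in M. g3 w \<le> g1 w" by eventually_elim simp
      with * show "((Q1, g1), (Q3, g3)) \<in> s" by (auto simp: s_def)
    qed
    then show "preorder_on gauges s"
      using s_refl by (auto simp: preorder_on_def refl_on_def s_def)
    fix b b' assume bb': "b \<in> gauges" "b' \<in> gauges"
    obtain Q g Q' g' where [simp]: "b = (Q, g)" "b' = (Q', g')" by (cases b, cases b')
    have "AE w in M. 0 < g w" "AE w in M. 0 < g' w" using bb' by (auto simp: gauges_def)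
    then have "AE w in M. 0 < min (g w) (g' w)" by eventually_elim simp
    then have "(Q \<union> Q', \<lambda>w. min (g w) (g' w)) \<in> gauges" using bb' by (auto simp: gauges_def)
    with bb' show "\<exists>c\<in>gauges. (b, c) \<in> s \<and> (b', c) \<in> s"
      by (intro bexI[of _ "(Q \<union> Q', \<lambda>w. min (g w) (g' w))"]) (auto simp: s_def)
  qed
  moreover have "Cauchy_net E (T_c M E P) gauges s y"
    unfolding Cauchy_net_T_c_iff
  proof (intro conjI yc ballI, clarify)
    fix Q g assume Qg: "(Q, g) \<in> gauges"
    \<comment> \<open>Halving compensates for the factor 2 in
      \<open>near_limit_close\<close>.\<close>
    then have half: "(Q, \<lambda>w. g w / 2) \<in> gauges" by (auto simp: gauges_def)
    have "y b \<ominus>\<^bsub>E\<^esub> y c \<in> as_nbhd Q g"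
      if "b \<in> gauges" "c \<in> gauges" "((Q, \<lambda>w. g w / 2), b) \<in> s" "((Q, \<lambda>w. g w / 2), c) \<in> s" for b c
    proof -
      have "y b \<in> carrier E" "y c \<in> carrier E" using yc that by auto
      then show ?thesis
        using near_limit_close[OF half y_near[OF that(3)] y_near[OF that(4)]] by (simp add: as_nbhd_def)
    qed
    with half show "\<exists>i\<in>gauges. \<forall>j\<in>gauges. \<forall>k\<in>gauges. (i, j) \<in> s \<and> (i, k) \<in> s \<longrightarrow>
        y j \<ominus>\<^bsub>E\<^esub> y k \<in> as_nbhd Q g" by blast
  qed
  \<comment> \<open>Gauges do not have the index type fixed in \<open>net_complete\<close>, hence
    the passage through \<open>net_complete_any_index\<close>.\<close>
  ultimately obtain l where conv: "net_converges (T_c M E P) gauges s y l"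
    using net_complete_any_index[OF complete] by blast
  then have l: "l \<in> carrier E" by (simp add: net_converges_T_c_iff[OF yc])
  have "net_converges (T_eps_lambda M E P) I r x l"
    unfolding net_converges_T_eps_lambda_iff[OF xI]
  proof (intro conjI l allI impI)
    fix Q and e :: real assume "finite Q \<and> Q \<subseteq> P \<and> 0 < e"
    then have fin: "finite Q" "Q \<subseteq> P" and e: "0 < e" by auto
    let ?q = "(Q, \<lambda>_. e/4) :: ('e \<Rightarrow> ('w \<Rightarrow> real) set) set \<times> ('w \<Rightarrow> real)"
    have q: "?q \<in> gauges" using fin e by (simp add: gauges_def)
    obtain b where b: "b \<in> gauges" "\<And>c. c \<in> gauges \<Longrightarrow> (b, c) \<in> s \<Longrightarrow> y c \<ominus>\<^bsub>E\<^esub> l \<in> as_nbhd Q (\<lambda>_. e/4)"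
      using conv q unfolding net_converges_T_c_iff[OF yc] by blast
    \<comment> \<open>Lying beyond \<open>b\<close> puts \<open>y c\<close> within
      \<open>e/4\<close> of \<open>l\<close>; lying beyond \<open>?q\<close> puts it in
      \<open>near_limit Q\<close> with radius \<open>e/4\<close>. Taking deviation
      \<open>e/4\<close> there as well, \<open>x j\<close> is within \<open>3*e/4\<close> of
      \<open>l\<close> outside an event of probability below \<open>e/4\<close>.\<close>
    obtain c where c: "c \<in> gauges" "(b, c) \<in> s" "(?q, c) \<in> s"
      using directed_bound[OF \<open>directed gauges s\<close> b(1) q] by blast
    have z: "y c \<in> carrier E" using yc c by blast
    have zl: "AE w in M. seminorm_rep Q (y c \<ominus>\<^bsub>E\<^esub> l) w \<le> e/4"
      using b(2)[OF c(1,2)] by (simp add: as_nbhd_def)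
    have "0 < e/4" using e by simp
    then obtain i where i: "i \<in> I" "\<And>j. j \<in> I \<Longrightarrow> (i, j) \<in> r \<Longrightarrow>
        prob {w \<in> space M. e/4 + e/4 \<le> seminorm_rep Q (y c \<ominus>\<^bsub>E\<^esub> x j) w} < e/4"
      using y_near[OF c(3)] unfolding near_limit_def by blast
    have "x j \<ominus>\<^bsub>E\<^esub> l \<in> stoch_nbhd Q e" if j: "j \<in> I" "(i, j) \<in> r" for j
    proof -
      have xj: "x j \<in> carrier E" using j xI by blast
      have [measurable]: "seminorm_rep Q (y c \<ominus>\<^bsub>E\<^esub> x j) \<in> borel_measurable M"
        by (intro seminorm_rep_measurable[OF fin] E.minus_closed z xj)
      have "AE w in M. w \<in> {w \<in> space M. e \<le> seminorm_rep Q (x j \<ominus>\<^bsub>E\<^esub> l) w} \<longrightarrow>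
          w \<in> {w \<in> space M. e/4 + e/4 \<le> seminorm_rep Q (y c \<ominus>\<^bsub>E\<^esub> x j) w}"
        using seminorm_rep_triangle[OF fin xj z l] seminorm_rep_minus_commute[OF fin xj z] zl
        by eventually_elim (use e in auto)
      then have "prob {w \<in> space M. e \<le> seminorm_rep Q (x j \<ominus>\<^bsub>E\<^esub> l) w} \<le>
          prob {w \<in> space M. e/4 + e/4 \<le> seminorm_rep Q (y c \<ominus>\<^bsub>E\<^esub> x j) w}"
        by (rule finite_measure_mono_AE) measurable
      also have "\<dots> < e" using i(2)[OF j] e by simp
      finally show ?thesis using xj l by (simp add: stoch_nbhd_def)
    qed
    with i(1) show "\<exists>i\<in>I. \<forall>j\<in>I. (i, j) \<in> r \<longrightarrow> x j \<ominus>\<^bsub>E\<^esub> l \<in> stoch_nbhd Q e" by blast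
  qed
  then show ?thesis ..
qed

end

lemma T_eps_lambda_complete_if_T_c_complete:
  assumes "net_complete E (T_c M E P)" "countable_concatenation_property M E"
  shows "net_complete E (T_eps_lambda M E P)"
  unfolding net_complete_def
proof (intro allI impI, elim conjE)
  fix I :: "('e set \<times> 'e) set" and r x
  assume dir: "directed I r" and C: "Cauchy_net E (T_eps_lambda M E P) I r x"
  then have "x ` I \<subseteq> carrier E" by (simp add: Cauchy_net_def)
  from net_converges_T_eps_lambda[OF dir this assms C]
  show "\<exists>l. net_converges (T_eps_lambda M E P) I r x l" .
qed

end

theorem theorem3p28:
  fixes M :: "'w measure"
    and E :: "(('w \<Rightarrow> 'k::{real_normed_field,euclidean_space}) set, 'e) module"
    and P :: "('e \<Rightarrow> ('w \<Rightarrow> real) set) set"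
  assumes "random_locally_convex_module M E P"
  shows "(net_complete E (T_eps_lambda M E P) \<longrightarrow> net_complete E (T_c M E P)) \<and>
         (net_complete E (T_c M E P) \<and> countable_concatenation_property M E
            \<longrightarrow> net_complete E (T_eps_lambda M E P))"
  using T_c_complete_if_T_eps_lambda_complete[OF assms]
    T_eps_lambda_complete_if_T_c_complete[OF assms] by blast

end
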